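(* Let $A_n=\left(x_{L_n(i,j)}\mathbf 1_{\Delta_n}(i,j)\right)_{i,j=1}^{N}$, $n\ge 1$, be a sequence of $N\times N$ symmetric random matrices (with $N=N(n)$), and let $p$ be a fixed even positive integer. Suppose that (i) there is a constant $B<\infty$ such that $\sup_n\sup_{t\in\mathbb Z^d}\sup_{1\le k\le N(n)}\#\{l:1\le l\le N(n),\ L_n(k,l)=t\}\le B$; (ii) $\{x_i:i\in\mathbb Z^d\}$ are independent random variables with mean zero and uniformly bounded moments of all orders, i.e. $\sup_i\mathbb E|x_i|^k<\infty$ for every $k\in\mathbb N$; (iii) there exists a constant $c>0$ such that $cN\le\operatorname{Var}\left(\operatorname{Tr}\left(\frac{A_n}{\sqrt N}\right)^{p}\right)$ for all $n$. Then $$\eta_{p}=\frac{\operatorname{Tr}\left(\frac{A_n}{\sqrt N}\right)^{p}-\mathbb E\operatorname{Tr}\left(\frac{A_n}{\sqrt N}\right)^{p}}{\sqrt{\operatorname{Var}\left(\operatorname{Tr}\left(\frac{A_n}{\sqrt N}\right)^{p}\right)}}$$ converges in distribution to the standard Gaussian distribution $N(0,1)$ as $n\to\infty$.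
   Context: Notation: $[N]=\{1,2,\ldots,N\}$. Fix $d\in\mathbb N$ and a strictly increasing function $N:\mathbb N\to\mathbb N$; write $N$ for $N(n)$. For each $n$, $L_n:[N(n)]^2\to\mathbb Z^d$ is a symmetric link function, i.e. $L_n(i,j)=L_n(j,i)$ for all $i,j$, and $\Delta_n\subseteq[N(n)]^2$ is a set such that $(i,j)\in\Delta_n$ implies $(j,i)\in\Delta_n$. The input sequence is a family $\{x_i:i\in\mathbb Z^d\}$ of real random variables. The $(i,j)$ entry of $A_n$ is $x_{L_n(i,j)}$ if $(i,j)\in\Delta_n$ and $0$ otherwise. *)

theory Defs
  imports "HOL-Probability.Probability" "Jordan_Normal_Form.Matrix"
begin

definition mat_trace :: "'a :: comm_monoid_add mat \<Rightarrow> 'a" where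
  "mat_trace A = (\<Sum>i<dim_row A. A $$ (i, i))"

text \<open>
  The symmetric patterned matrix of size \<open>N\<close> with link function \<open>L\<close>, support \<open>D\<close> and input \<open>y\<close>.
  Link functions and supports live on \<open>{1..N}\<close>, whereas the entries of a \<open>mat\<close> are indexed from 0;
  hence the shift by \<open>Suc\<close>.
\<close>
definition link_matrix ::
    "nat \<Rightarrow> (nat \<Rightarrow> nat \<Rightarrow> 'i) \<Rightarrow> (nat \<times> nat) set \<Rightarrow> ('i \<Rightarrow> real) \<Rightarrow> real mat" where
  "link_matrix N L D y =
     mat N N (\<lambda>(i, j). if (Suc i, Suc j) \<in> D then y (L (Suc i) (Suc j)) else 0)"

definition trace_power ::
    "nat \<Rightarrow> nat \<Rightarrow> (nat \<Rightarrow> nat \<Rightarrow> 'i) \<Rightarrow> (nat \<times> nat) set \<Rightarrow> ('i \<Rightarrow> 'w \<Rightarrow> real) \<Rightarrow> 'w \<Rightarrow> real" where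
  "trace_power p N L D x \<omega> =
     mat_trace (((1 / sqrt (real N)) \<cdot>\<^sub>m link_matrix N L D (\<lambda>t. x t \<omega>)) ^\<^sub>m p)"

definition (in prob_space) standardized :: "('a \<Rightarrow> real) \<Rightarrow> 'a \<Rightarrow> real" where
  "standardized X \<omega> = (X \<omega> - expectation X) / sqrt (variance X)"

end

theory Submission
  imports Defs
begin

text \<open>
  The proof is by the method of moments. Expanding the trace over closed walks of length \<open>p\<close>
  (circuits) turns the centred trace into \<open>N powr (- p / 2)\<close> times a fluctuation
  \<open>S = (\<Sum>c. a c * (W c - E (W c)))\<close>, where \<open>W c\<close> is the product of the \<open>p\<close> inputs read along the
  circuit \<open>c\<close>. Call the sequence of indices read along \<open>c\<close> the word of \<open>c\<close> and the indices its
  letters. The \<open>k\<close>-th moment of \<open>S\<close> is a sum, over families of \<open>k\<close> circuits, of joint moments of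
  centred words.

  By independence and since the inputs are centred, a joint moment vanishes unless the family is
  essential: every letter occurs at least twice, and every word shares a letter with another one
  (\<open>joint_moment_nonessential\<close>). If moreover no word meets two others, the words are matched in
  pairs and the joint moment factors over these pairs; it then agrees with the corresponding term
  of Wick's formula for Gaussian variables, \<open>E (S^k) = (k - 1) * E (S^2) * E (S^(k - 2))\<close>
  (\<open>joint_moment_wick\<close>). Hence the error in this formula is controlled by the number of
  essential families that are branching, i.e. in which some word meets two others.

  This number is \<open>O(N powr ((k * (p + 1) - 1) / 2))\<close> (\<open>card_branching_families_le\<close>), for the
  following reason. Read the circuits one after the other. A circuit costs one free vertex to start
  with and one for every letter that has not been met before; the other vertices are determined up
  to \<open>B\<close> choices by the vertex before and the letter between them. If a letter is new and occurs
  only once in its circuit, the circuit can be started right behind it: the walk closes up by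
  itself and this letter costs nothing. Now read the circuits in the reverse order too. In an
  essential family every circuit costs at most \<open>p + 1\<close> in both readings together, and at most \<open>p\<close>
  if one of its neighbours comes before it and another one after it (\<open>freedom_add_reverse\<close>; here
  \<open>p\<close> has to be even). So the product of the two bounds has exponent at most \<open>k * (p + 1) - 1\<close>.

  The lower bound on the variance says that \<open>E (S^2)\<close> is at least \<open>c * N^(p + 1)\<close>. After division
  by \<open>sqrt (E (S^2)) ^ k\<close> the error is therefore \<open>O(1 / sqrt N)\<close>, and the normalised moments satisfy
  in the limit the recurrence of the standard normal moments. Characteristic functions turn the
  convergence of moments into convergence in distribution (\<open>weak_conv_m_std_normal_of_moments\<close>).
\<close>

section \<open>Families of words and their letters\<close>

definition letters :: "nat \<Rightarrow> (nat \<Rightarrow> 'b) \<Rightarrow> 'b set" where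
  "letters p u = u ` {..<p}"

text \<open>
  The two conditions without which a joint moment of centred words vanishes. The second one does not
  follow from the first: a word may consist of letters that are repeated within this word only.
\<close>

definition essential :: "nat \<Rightarrow> nat set \<Rightarrow> (nat \<Rightarrow> nat \<Rightarrow> 'b) \<Rightarrow> bool" where
  "essential p J U \<longleftrightarrow>
     (\<forall>j\<in>J. \<forall>s<p. \<exists>j'\<in>J. \<exists>s'<p. (j', s') \<noteq> (j, s) \<and> U j' s' = U j s) \<and>
     (\<forall>j\<in>J. \<exists>j'\<in>J. j' \<noteq> j \<and> letters p (U j') \<inter> letters p (U j) \<noteq> {})"

text \<open>
  Some word meets two others. Without this, an essential family is a perfect matching of its words.
\<close>

definition branching :: "nat \<Rightarrow> nat set \<Rightarrow> (nat \<Rightarrow> nat \<Rightarrow> 'b) \<Rightarrow> bool" where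
  "branching p J U \<longleftrightarrow>
     (\<exists>j\<in>J. \<exists>i\<in>J. \<exists>l\<in>J. i \<noteq> j \<and> l \<noteq> j \<and> i \<noteq> l \<and>
       letters p (U i) \<inter> letters p (U j) \<noteq> {} \<and> letters p (U l) \<inter> letters p (U j) \<noteq> {})"

lemma letters_meet_iff:
  "letters p u \<inter> letters p v \<noteq> {} \<longleftrightarrow> (\<exists>s<p. \<exists>s'<p. u s = v s')"
  by (auto simp: letters_def)

text \<open>
  Both notions depend only on which positions carry equal letters. So circuits can be counted
  separately for each of the finitely many patterns of coincidences.
\<close>

lemma essential_branching_cong:
  assumes "\<And>j s j' s'. j \<in> J \<Longrightarrow> s < p \<Longrightarrow> j' \<in> J \<Longrightarrow> s' < p \<Longrightarrow>
             U j s = U j' s' \<longleftrightarrow> V j s = V j' s'"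
  shows "essential p J U \<longleftrightarrow> essential p J V" "branching p J U \<longleftrightarrow> branching p J V"
  unfolding essential_def branching_def letters_meet_iff
  using assms by (simp_all cong: conj_cong)

section \<open>Counting families of circuits\<close>

text \<open>
  The multiplication principle for dependent choices: the bound for a coordinate may use the values of
  all coordinates of smaller rank. In this way closed walks can be counted vertex by vertex.
\<close>

lemma card_le_prod_extensions:
  fixes ev :: "'x \<Rightarrow> 'v \<Rightarrow> 'a" and rank :: "'v \<Rightarrow> nat"
  assumes "finite V" "inj_on rank V" and fX: "finite X"
    and sep: "\<And>x y. x \<in> X \<Longrightarrow> y \<in> X \<Longrightarrow> (\<And>v. v \<in> V \<Longrightarrow> ev x v = ev y v) \<Longrightarrow> x = y"
    and step: "\<And>v g. v \<in> V \<Longrightarrow> g \<in> X \<Longrightarrow>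
      card ((\<lambda>x. ev x v) ` {x\<in>X. \<forall>u\<in>V. rank u < rank v \<longrightarrow> ev x u = ev g u}) \<le> b v"
  shows "card X \<le> (\<Prod>v\<in>V. b v)"
proof -
  have "card ((\<lambda>x. restrict (ev x) V) ` X) \<le> (\<Prod>v\<in>V. b v)"
    using assms(1,2) step
  proof (induction V rule: finite_ranking_induct[where f = rank])
    case empty
    show ?case by (cases "X = {}") (auto simp: restrict_def image_constant_conv)
  next
    case (insert v S)
    let ?R = "\<lambda>x. restrict (ev x) S"
    let ?F = "\<lambda>h. (\<lambda>x. ev x v) ` {x\<in>X. ?R x = h}"
    show ?case
    proof (cases "v \<in> S")
      case True
      then show ?thesis using insert.IH insert.prems by (simp add: insert_absorb)
    next
      case False
      have less: "rank u < rank v" if "u \<in> S" for u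
      proof -
        have "rank v \<noteq> rank u" using insert.prems(1) that False by (auto simp: inj_on_insert)
        with insert.hyps(2)[OF that] show ?thesis by simp
      qed
      have IH: "card (?R ` X) \<le> prod b S"
      proof (rule insert.IH)
        show "inj_on rank S" using insert.prems(1) by simp
        fix u g assume u: "u \<in> S" and g: "g \<in> X"
        have "(\<forall>w\<in>insert v S. rank w < rank u \<longrightarrow> ev x w = ev g w) \<longleftrightarrow>
              (\<forall>w\<in>S. rank w < rank u \<longrightarrow> ev x w = ev g w)" for x
          using less[OF u] by auto
        then show "card ((\<lambda>x. ev x u) ` {x \<in> X. \<forall>w\<in>S. rank w < rank u \<longrightarrow> ev x w = ev g w}) \<le> b u"
          using insert.prems(2)[of u g] u g by simp
      qed
      have fib: "card (?F h) \<le> b v" if "h \<in> ?R ` X" for h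
      proof -
        from that obtain g where g: "g \<in> X" "h = ?R g" by auto
        have "?R x = h \<longleftrightarrow> (\<forall>u\<in>insert v S. rank u < rank v \<longrightarrow> ev x u = ev g u)" for x
          unfolding g(2) using less by (auto simp: restrict_def fun_eq_iff)
        then show ?thesis using insert.prems(2)[of v g] g(1) by simp
      qed
      let ?split = "\<lambda>h. (restrict h S, h v)"
      have "card ((\<lambda>x. restrict (ev x) (insert v S)) ` X) \<le> card (Sigma (?R ` X) ?F)"
      proof (rule card_inj_on_le[of ?split])
        have split: "?split (restrict (ev x) (insert v S)) = (?R x, ev x v)" for x
          by (auto simp: restrict_def fun_eq_iff)
        show "inj_on ?split ((\<lambda>x. restrict (ev x) (insert v S)) ` X)"
        proof (rule inj_onI, elim imageE, hypsubst)
          fix x y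
          assume "?split (restrict (ev x) (insert v S)) = ?split (restrict (ev y) (insert v S))"
          then have "?R x = ?R y" "ev x v = ev y v" unfolding split by auto
          then show "restrict (ev x) (insert v S) = restrict (ev y) (insert v S)"
            unfolding restrict_def fun_eq_iff by (metis insert_iff)
        qed
        show "?split ` (\<lambda>x. restrict (ev x) (insert v S)) ` X \<subseteq> Sigma (?R ` X) ?F"
          unfolding image_image split by blast
        show "finite (Sigma (?R ` X) ?F)" using fX by auto
      qed
      also have "\<dots> = (\<Sum>h\<in>?R ` X. card (?F h))"
        using fX by (intro card_SigmaI) auto
      also have "\<dots> \<le> (\<Sum>h\<in>?R ` X. b v)" by (rule sum_mono) (rule fib)
      also have "\<dots> \<le> prod b (insert v S)"
        using IH insert.hyps False by (simp add: mult.commute)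
      finally show ?thesis .
    qed
  qed
  moreover have "inj_on (\<lambda>x. restrict (ev x) V) X"
  proof (rule inj_onI)
    fix x y assume "x \<in> X" "y \<in> X" and eq: "restrict (ev x) V = restrict (ev y) V"
    then show "x = y" using sep by (metis restrict_apply')
  qed
  ultimately show ?thesis by (simp add: card_image)
qed

definition circuits :: "nat \<Rightarrow> nat \<Rightarrow> (nat \<Rightarrow> nat) set" where
  "circuits p N = PiE {..<p} (\<lambda>_. {..<N})"

definition word :: "nat \<Rightarrow> (nat \<Rightarrow> nat \<Rightarrow> 'i) \<Rightarrow> (nat \<Rightarrow> nat) \<Rightarrow> nat \<Rightarrow> 'i" where
  "word p L c s = L (c s) (c (Suc s mod p))"

lemma finite_circuits [simp]: "finite (circuits p N)"
  by (simp add: circuits_def finite_PiE)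

definition fresh :: "nat \<Rightarrow> nat set \<Rightarrow> (nat \<Rightarrow> nat) \<Rightarrow> (nat \<Rightarrow> nat \<Rightarrow> 'b) \<Rightarrow> nat \<Rightarrow> 'b set" where
  "fresh p J pos U j = letters p (U j) - (\<Union>i\<in>{i\<in>J. pos i < pos j}. letters p (U i))"

text \<open>
  The position \<open>s\<close> of the circuit \<open>j\<close> carries a fresh letter that the circuit does not repeat. A walk
  that starts right behind this position ends with it, and so never has to choose its letter.
\<close>

definition closing :: "nat \<Rightarrow> nat set \<Rightarrow> (nat \<Rightarrow> nat) \<Rightarrow> (nat \<Rightarrow> nat \<Rightarrow> 'b) \<Rightarrow> nat \<Rightarrow> nat \<Rightarrow> bool" where
  "closing p J pos U j s \<longleftrightarrow>
     s < p \<and> U j s \<in> fresh p J pos U j \<and> (\<forall>s'<p. U j s' = U j s \<longrightarrow> s' = s)"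

text \<open>
  The number of free vertices of the circuit \<open>j\<close> when the circuits are read in the order of \<open>pos\<close>: one
  for every fresh letter, and the start; if there is a closing position, its letter is saved.
\<close>

definition freedom :: "nat \<Rightarrow> nat set \<Rightarrow> (nat \<Rightarrow> nat) \<Rightarrow> (nat \<Rightarrow> nat \<Rightarrow> 'b) \<Rightarrow> nat \<Rightarrow> nat" where
  "freedom p J pos U j = card (fresh p J pos U j) + (if \<exists>s. closing p J pos U j s then 0 else 1)"

text \<open>
  Circuits are revealed in the order of \<open>pos\<close>, and each circuit vertex by vertex along the walk, from
  behind its closing position if there is one. A vertex that is reached through a letter already seen
  has at most \<open>B\<close> values, because the vertex before it and that letter are known. The pattern \<open>\<kappa>\<close>
  prescribes coincidences of letters, so that the free vertices are the same for all families.
\<close>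

lemma card_circuit_families_le:
  fixes L :: "nat \<Rightarrow> nat \<Rightarrow> 'i" and \<kappa> :: "nat \<Rightarrow> nat \<Rightarrow> 'b"
  assumes p: "0 < p" and N: "1 \<le> N" and B: "1 \<le> B" and J: "finite J" and inj: "inj_on pos J"
    and bound: "\<And>i t. i < N \<Longrightarrow> card {l. l < N \<and> L i l = t} \<le> B"
  shows "card {C \<in> PiE J (\<lambda>_. circuits p N).
            \<forall>j\<in>J. \<forall>s<p. \<forall>j'\<in>J. \<forall>s'<p. \<kappa> j s = \<kappa> j' s' \<longrightarrow> word p L (C j) s = word p L (C j') s'}
         \<le> B ^ (p * card J) * N ^ (\<Sum>j\<in>J. freedom p J pos \<kappa> j)" (is "card ?X \<le> _")
proof -
  define X where "X = ?X"
  \<comment> \<open>\<open>slot j m\<close> is the vertex that the walk along the circuit \<open>j\<close> visits at time \<open>m\<close>. If there is no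
    closing position, \<open>q j\<close> is arbitrary, and so is the start.\<close>
  define q where "q j = (SOME s. closing p J pos \<kappa> j s)" for j
  define r where "r j = Suc (q j) mod p" for j
  define slot where "slot j m = (r j + m) mod p" for j m
  define ev where "ev = (\<lambda>C (j, m). C j (slot j m) :: nat)"
  define rank where "rank = (\<lambda>(j, m). pos j * p + m)"
  define V where "V = J \<times> {..<p}"
  define G where "G j = {m \<in> {1..<p}. \<kappa> j (slot j (m - 1)) \<in> fresh p J pos \<kappa> j \<and>
      (\<forall>m'<m - 1. \<kappa> j (slot j m') \<noteq> \<kappa> j (slot j (m - 1)))}" for j
  define free where "free j = insert 0 (G j)" for j
  \<comment> \<open>the factor \<open>B\<close> is wasted on the free vertices, which keeps the product simple\<close>
  define b where "b v = (if v \<in> Sigma J free then N else 1) * B" for v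
  have slot_less: "slot j m < p" for j m using p by (simp add: slot_def)
  have slot_Suc: "Suc (slot j m) mod p = slot j (Suc m)" for j m
    by (simp add: slot_def mod_Suc_eq)
  have slot_surj: "\<exists>m<p. slot j m = s" if "s < p" for j s
  proof -
    have "r j < p" using p by (simp add: r_def)
    then have "slot j ((s + p - r j) mod p) = s"
      using that p by (simp add: slot_def mod_add_right_eq)
    then show ?thesis using p by (metis mod_less_divisor)
  qed
  have rank_less: "rank (i, m') < rank (j, m)" if "pos i < pos j" "m' < p" for i j m m'
  proof -
    have "pos i * p + m' < Suc (pos i) * p" using that by simp
    also have "\<dots> \<le> pos j * p" using that by (intro mult_le_mono1) simp
    finally show ?thesis by (simp add: rank_def)
  qed
  have rank_inj: "inj_on rank V"
  proof (rule inj_onI, clarsimp simp: V_def)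
    fix i m j m' assume h: "i \<in> J" "m < p" "j \<in> J" "m' < p" "rank (i, m) = rank (j, m')"
    have "pos i = pos j"
      using rank_less[of i j m m'] rank_less[of j i m' m] h by (metis nat_neq_iff)
    then show "i = j \<and> m = m'" using inj h by (auto simp: rank_def dest: inj_onD)
  qed
  have X_PiE: "C \<in> PiE J (\<lambda>_. circuits p N)" if "C \<in> X" for C using that by (simp add: X_def)
  have X_same: "word p L (C j) s = word p L (C j') s'"
    if "C \<in> X" "j \<in> J" "s < p" "j' \<in> J" "s' < p" "\<kappa> j s = \<kappa> j' s'" for C j s j' s'
    using that unfolding X_def by blast
  have range: "C j s < N" if "C \<in> X" "j \<in> J" "s < p" for C j s
    using that by (auto simp: X_def circuits_def PiE_iff)
  have "card X \<le> (\<Prod>v\<in>V. b v)"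
  proof (rule card_le_prod_extensions[where ev = ev and rank = rank])
    show "finite V" using J by (simp add: V_def)
    show "finite X" unfolding X_def using J by (intro finite_subset[OF _ finite_PiE[of J "\<lambda>_. circuits p N"]]) auto
    show "inj_on rank V" by (rule rank_inj)
  next
    fix x y assume x: "x \<in> X" and y: "y \<in> X" and eq: "\<And>v. v \<in> V \<Longrightarrow> ev x v = ev y v"
    show "x = y"
    proof (rule PiE_ext[of x J "\<lambda>_. circuits p N"])
      fix j assume j: "j \<in> J"
      show "x j = y j"
      proof (rule PiE_ext[of _ "{..<p}" "\<lambda>_. {..<N}"])
        fix s assume "s \<in> {..<p}"
        then obtain m where "m < p" "slot j m = s" using slot_surj by auto
        then show "x j s = y j s" using eq[of "(j, m)"] j by (simp add: V_def ev_def)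
      qed (use X_PiE[OF x] X_PiE[OF y] j in \<open>auto simp: circuits_def PiE_iff\<close>)
    qed (use X_PiE[OF x] X_PiE[OF y] in auto)
  next
    fix v g assume v: "v \<in> V" and g: "g \<in> X"
    obtain j m where jm: "v = (j, m)" "j \<in> J" "m < p" using v by (auto simp: V_def)
    define Y where "Y = {x \<in> X. \<forall>u\<in>V. rank u < rank v \<longrightarrow> ev x u = ev g u}"
    have YX: "x \<in> X" if "x \<in> Y" for x using that by (simp add: Y_def)
    have earlier: "x i s = g i s" if "x \<in> Y" "i \<in> J" "s < p" "pos i < pos j" for x i s
    proof -
      from slot_surj[OF \<open>s < p\<close>] obtain m' where "m' < p" "slot i m' = s" by blast
      then show ?thesis
        using that rank_less[of i j m' m] by (force simp: Y_def V_def ev_def jm)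
    qed
    have same: "x j (slot j m') = g j (slot j m')" if "x \<in> Y" "m' < m" for x m'
      using that jm by (force simp: Y_def V_def ev_def rank_def)
    have "card ((\<lambda>x. ev x v) ` Y) \<le> b v"
    proof (cases "m \<in> free j")
      case True
      have "(\<lambda>x. ev x v) ` Y \<subseteq> {..<N}"
        using range[OF YX jm(2) slot_less] by (auto simp: ev_def jm)
      from card_mono[OF _ this] have "card ((\<lambda>x. ev x v) ` Y) \<le> N" by simp
      also have "\<dots> \<le> b v" using True jm B by (simp add: b_def)
      finally show ?thesis .
    next
      case False
      then have m: "1 \<le> m" by (auto simp: free_def)
      \<comment> \<open>some earlier edge carries the same letter, so the next vertex has at most \<open>B\<close> values\<close>
      have "\<exists>i\<in>J. \<exists>s<p. \<kappa> i s = \<kappa> j (slot j (m - 1)) \<and>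
              (\<forall>x\<in>Y. word p L (x i) s = word p L (g i) s)"
      proof (cases "\<kappa> j (slot j (m - 1)) \<in> fresh p J pos \<kappa> j")
        case True
        then obtain m' where m': "m' < m - 1" "\<kappa> j (slot j m') = \<kappa> j (slot j (m - 1))"
          using False m jm by (auto simp: free_def G_def)
        have "word p L (x j) (slot j m') = word p L (g j) (slot j m')" if "x \<in> Y" for x
          using same[OF that, of m'] same[OF that, of "Suc m'"] m' by (simp add: word_def slot_Suc)
        then show ?thesis using m' jm slot_less by blast
      next
        case False
        then obtain i s where i: "i \<in> J" "pos i < pos j" "s < p" "\<kappa> i s = \<kappa> j (slot j (m - 1))"
          using slot_less by (force simp: fresh_def letters_def)
        have "word p L (x i) s = word p L (g i) s" if "x \<in> Y" for x
          using earlier[OF that i(1) _ i(2)] i(3) p by (simp add: word_def)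
        then show ?thesis using i by blast
      qed
      then obtain i s where i: "i \<in> J" "s < p" "\<kappa> i s = \<kappa> j (slot j (m - 1))"
        "\<And>x. x \<in> Y \<Longrightarrow> word p L (x i) s = word p L (g i) s" by blast
      let ?w = "g j (slot j (m - 1))"
      have "(\<lambda>x. ev x v) ` Y \<subseteq> {l. l < N \<and> L ?w l = word p L (g i) s}"
      proof (rule image_subsetI)
        fix x assume x: "x \<in> Y"
        have "word p L (x j) (slot j (m - 1)) = word p L (x i) s"
          using X_same[OF YX[OF x] jm(2) slot_less i(1,2)] i(3) by simp
        then have "L ?w (x j (slot j m)) = word p L (g i) s"
          using i(4)[OF x] same[OF x, of "m - 1"] m by (simp add: word_def slot_Suc)
        then show "ev x v \<in> {l. l < N \<and> L ?w l = word p L (g i) s}"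
          using range[OF YX[OF x] jm(2) slot_less] by (simp add: ev_def jm)
      qed
      from card_mono[OF _ this] have "card ((\<lambda>x. ev x v) ` Y) \<le> card {l. l < N \<and> L ?w l = word p L (g i) s}"
        by simp
      also have "\<dots> \<le> B" using range[OF g jm(2) slot_less] by (rule bound)
      also have "\<dots> \<le> b v" using N by (simp add: b_def)
      finally show ?thesis .
    qed
    then show "card ((\<lambda>x. ev x v) ` {x \<in> X. \<forall>u\<in>V. rank u < rank v \<longrightarrow> ev x u = ev g u}) \<le> b v"
      by (simp only: Y_def)
  qed
  also have "(\<Prod>v\<in>V. b v) = (\<Prod>v\<in>V. if v \<in> Sigma J free then N else 1) * B ^ (p * card J)"
    unfolding b_def prod.distrib using J by (simp add: V_def card_cartesian_product mult.commute)
  also have "(\<Prod>v\<in>V. if v \<in> Sigma J free then N else 1) = N ^ card (Sigma J free)"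
  proof -
    have "Sigma J free \<subseteq> V" using p by (auto simp: V_def free_def G_def)
    then show ?thesis using J by (simp add: V_def prod.If_cases Int_absorb1)
  qed
  also have "card (Sigma J free) = (\<Sum>j\<in>J. card (free j))"
    using J by (intro card_SigmaI) (auto simp: free_def G_def)
  also have "N ^ (\<Sum>j\<in>J. card (free j)) \<le> N ^ (\<Sum>j\<in>J. freedom p J pos \<kappa> j)"
  proof (rule power_increasing[OF sum_mono N])
    fix j assume j: "j \<in> J"
    let ?F = "fresh p J pos \<kappa> j" and ?l = "\<lambda>m. \<kappa> j (slot j (m - 1))"
    have fin: "finite ?F" by (simp add: fresh_def letters_def)
    \<comment> \<open>distinct free vertices are reached through distinct fresh letters, and none through the
      letter of the closing position\<close>
    have "inj_on ?l (G j)"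
    proof (rule linorder_inj_onI)
      fix m m' assume "m < m'" "m \<in> G j" "m' \<in> G j"
      then show "?l m \<noteq> ?l m'" by (auto simp: G_def)
    qed auto
    then have card_G: "card (G j) = card (?l ` G j)" by (simp add: card_image)
    have "card (G j) + (if \<exists>s. closing p J pos \<kappa> j s then 1 else 0) \<le> card ?F"
    proof (cases "\<exists>s. closing p J pos \<kappa> j s")
      case False
      then show ?thesis unfolding card_G using fin by (auto intro!: card_mono simp: G_def)
    next
      case True
      then have q: "closing p J pos \<kappa> j (q j)" unfolding q_def by (rule someI_ex)
      have "\<kappa> j (q j) \<noteq> ?l m" if "m \<in> G j" for m
      proof
        assume "\<kappa> j (q j) = ?l m"
        then have "slot j (m - 1) = q j" using q slot_less by (metis closing_def)
        moreover have "slot j (m - 1) = (q j + m) mod p"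
          unfolding slot_def r_def mod_add_left_eq using that by (simp add: G_def)
        ultimately have "(q j + m) mod p = q j" by simp
        moreover have "q j < p" using q by (simp add: closing_def)
        ultimately show False using that by (auto simp: G_def mod_if split: if_splits)
      qed
      then have "?l ` G j \<subseteq> ?F - {\<kappa> j (q j)}"
        by (intro image_subsetI) (force simp: G_def)
      then have "card (?l ` G j) \<le> card (?F - {\<kappa> j (q j)})" using fin by (intro card_mono) auto
      moreover have "Suc (card (?F - {\<kappa> j (q j)})) = card ?F"
        using q by (intro card_Suc_Diff1 fin) (simp add: closing_def)
      ultimately show ?thesis unfolding card_G using True by simp
    qed
    moreover have "card (free j) \<le> Suc (card (G j))"
      by (simp add: free_def G_def card_insert_if)
    ultimately show "card (free j) \<le> freedom p J pos \<kappa> j"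
      by (auto simp: freedom_def split: if_splits)
  qed
  finally show ?thesis by (simp add: mult.commute X_def)
qed

text \<open>
  For a letter \<open>t\<close> of the circuit \<open>j\<close> let \<open>\<mu> t\<close> be its multiplicity there, and let \<open>\<delta> t\<close> be \<open>\<mu> t\<close>
  minus the number (0, 1 or 2) of readings in which \<open>t\<close> is fresh. Then \<open>\<delta> t \<ge> 0\<close>, since a letter that is
  fresh both times occurs in no other circuit, and hence twice in this one. As the multiplicities add up
  to \<open>p\<close>, the two freedoms add up to \<open>p + 2\<close> minus the sum of the \<open>\<delta> t\<close> and minus the number of readings
  with a closing position. A letter shared with another circuit is not fresh both times. So either it
  has \<open>\<delta> t \<ge> 1\<close>, or it occurs once and is closing in one reading: at least one unit is saved.

  For the second bound, the letters shared with the two neighbours save one unit each if they are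
  different, since the first can only be closing in the reverse reading and the second only in the
  direct one. If they are the same letter \<open>t\<close>, it is fresh in no reading and \<open>\<delta> t = \<mu> t\<close>. In case this
  is only 1, parity provides another letter of odd multiplicity, which saves the second unit.
\<close>

lemma freedom_add_reverse:
  assumes inj: "inj_on pos J"
    and rev: "\<And>i j. i \<in> J \<Longrightarrow> j \<in> J \<Longrightarrow> pos' i < pos' j \<longleftrightarrow> pos j < pos i"
    and ess: "essential p J U" and j: "j \<in> J"
  shows "freedom p J pos U j + freedom p J pos' U j \<le> p + 1"
    and "\<lbrakk>even p; i \<in> J; l \<in> J; pos i < pos j; pos j < pos l;
          letters p (U i) \<inter> letters p (U j) \<noteq> {}; letters p (U l) \<inter> letters p (U j) \<noteq> {}\<rbrakk>
         \<Longrightarrow> freedom p J pos U j + freedom p J pos' U j \<le> p"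
proof -
  let ?L = "letters p (U j)"
  define F where "F = fresh p J pos U j"
  define F' where "F' = fresh p J pos' U j"
  define A :: int where "A = of_bool (\<exists>s. closing p J pos U j s)"
  define A' :: int where "A' = of_bool (\<exists>s. closing p J pos' U j s)"
  define \<mu> where "\<mu> t = card {s\<in>{..<p}. U j s = t}" for t
  define \<delta> where "\<delta> t = int (\<mu> t) - of_bool (t \<in> F) - of_bool (t \<in> F')" for t
  have fin: "finite ?L" by (simp add: letters_def)
  have FL: "F \<subseteq> ?L" "F' \<subseteq> ?L" by (auto simp: F_def F'_def fresh_def)
  have A01: "A \<ge> 0" "A' \<ge> 0" by (auto simp: A_def A'_def)
  have p_sum: "p = (\<Sum>t\<in>?L. \<mu> t)"
    using sum.image_gen[of "{..<p}" "\<lambda>_. 1::nat" "U j"] by (simp add: letters_def \<mu>_def)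
  have "(\<Sum>t\<in>?L. of_bool (t \<in> F)) = int (card F)" "(\<Sum>t\<in>?L. of_bool (t \<in> F')) = int (card F')"
    using FL fin by (auto simp: sum.If_cases of_bool_def Int_absorb1 intro!: arg_cong[of _ _ card])
  then have sum_\<delta>: "(\<Sum>t\<in>?L. \<delta> t) = int p - int (card F) - int (card F')"
    unfolding \<delta>_def by (subst (2) p_sum) (simp add: sum_subtractf)
  have free: "int (freedom p J pos U j + freedom p J pos' U j) = int p + 2 - ((\<Sum>t\<in>?L. \<delta> t) + A + A')"
    unfolding sum_\<delta> freedom_def A_def A'_def F_def F'_def by auto
  have \<mu>_pos: "\<mu> t \<ge> 1" if "t \<in> ?L" for t
  proof -
    have "{s\<in>{..<p}. U j s = t} \<noteq> {}" using that by (auto simp: letters_def)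
    then show ?thesis unfolding \<mu>_def by (simp add: Suc_le_eq card_gt_0_iff)
  qed
  have occurs: "\<exists>s<p. U j s = t" if "t \<in> ?L" for t
    using that by (auto simp: letters_def)
  have \<mu>1: "s' = s" if "\<mu> t = 1" "s < p" "s' < p" "U j s = t" "U j s' = t" for s s' t
  proof (rule ccontr)
    assume "s' \<noteq> s"
    then have "card {s, s'} = 2" by simp
    moreover have "card {s, s'} \<le> \<mu> t" unfolding \<mu>_def using that by (intro card_mono) auto
    ultimately show False using that by simp
  qed
  have close: "A = 1" if "\<mu> t = 1" "t \<in> F" for t
  proof -
    obtain s where s: "s < p" "U j s = t" using occurs FL(1) \<open>t \<in> F\<close> by blast
    then have "closing p J pos U j s"
      using that \<mu>1[OF that(1) s(1) _ s(2)] s unfolding closing_def F_def by metis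
    then show ?thesis by (auto simp: A_def)
  qed
  have close': "A' = 1" if "\<mu> t = 1" "t \<in> F'" for t
  proof -
    obtain s where s: "s < p" "U j s = t" using occurs FL(2) \<open>t \<in> F'\<close> by blast
    then have "closing p J pos' U j s"
      using that \<mu>1[OF that(1) s(1) _ s(2)] s unfolding closing_def F'_def by metis
    then show ?thesis by (auto simp: A'_def)
  qed
  have own: "t \<notin> letters p (U i)" if "t \<in> F" "t \<in> F'" "i \<in> J" "i \<noteq> j" for t i
  proof -
    have "pos i \<noteq> pos j" using inj that j by (auto dest: inj_onD)
    then have "pos i < pos j \<or> pos' i < pos' j" using rev that j by auto
    then show ?thesis using that by (auto simp: F_def F'_def fresh_def)
  qed
  have twice: "\<mu> t \<ge> 2" if "t \<in> F" "t \<in> F'" for t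
  proof -
    obtain s where s: "s < p" "U j s = t" using occurs FL(1) \<open>t \<in> F\<close> by blast
    then obtain i s' where i: "i \<in> J" "s' < p" "(i, s') \<noteq> (j, s)" "U i s' = t"
      using ess j unfolding essential_def by metis
    then have "i = j" using own[OF that, of i] by (auto simp: letters_def)
    then have "\<mu> t \<noteq> 1" using \<mu>1[of t s s'] s i by blast
    moreover have "\<mu> t \<ge> 1" using FL that by (intro \<mu>_pos) auto
    ultimately show ?thesis by simp
  qed
  have \<delta>0: "\<delta> t \<ge> 0" if "t \<in> ?L" for t
    using \<mu>_pos[OF that] twice[of t] by (auto simp: \<delta>_def of_bool_def)
  have one: "\<delta> t + A + A' \<ge> 1" if "t \<in> ?L" "t \<notin> F \<or> t \<notin> F' \<or> odd (\<mu> t)" for t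
    using \<mu>_pos[OF that(1)] twice[of t] that(2) close[of t] close'[of t] A01
    by (cases "\<mu> t = 1"; cases "\<mu> t = 2") (auto simp: \<delta>_def of_bool_def)
  have sum1: "(\<Sum>t\<in>?L. \<delta> t) \<ge> \<delta> t" if "t \<in> ?L" for t
    using that fin \<delta>0 by (intro member_le_sum) auto
  have sum2: "(\<Sum>t\<in>?L. \<delta> t) \<ge> \<delta> t + \<delta> u" if "t \<in> ?L" "u \<in> ?L" "t \<noteq> u" for t u
  proof -
    have "(\<Sum>v\<in>{t, u}. \<delta> v) \<le> (\<Sum>t\<in>?L. \<delta> t)"
      using that fin \<delta>0 by (intro sum_mono2) auto
    then show ?thesis using that by simp
  qed
  obtain m t where it: "m \<in> J" "m \<noteq> j" "t \<in> letters p (U m)" "t \<in> ?L"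
    using ess j unfolding essential_def by blast
  have "\<delta> t + A + A' \<ge> 1" using one[OF it(4)] own[of t m] it by blast
  then have "(\<Sum>t\<in>?L. \<delta> t) + A + A' \<ge> 1" using sum1[OF it(4)] by linarith
  then show "freedom p J pos U j + freedom p J pos' U j \<le> p + 1" using free by linarith
  assume ev: "even p" and il: "i \<in> J" "l \<in> J" "pos i < pos j" "pos j < pos l"
    and "letters p (U i) \<inter> ?L \<noteq> {}" "letters p (U l) \<inter> ?L \<noteq> {}"
  then obtain t u where t: "t \<in> letters p (U i)" "t \<in> ?L" and u: "u \<in> letters p (U l)" "u \<in> ?L"
    by blast
  have tF: "t \<notin> F" using t il by (auto simp: F_def fresh_def)
  have uF: "u \<notin> F'" using u il rev j by (auto simp: F'_def fresh_def)
  have "(\<Sum>t\<in>?L. \<delta> t) + A + A' \<ge> 2"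
  proof (cases "t = u")
    case False
    have "\<delta> t + A' \<ge> 1"
      using \<mu>_pos[OF t(2)] close'[of t] tF A01 by (cases "\<mu> t = 1") (auto simp: \<delta>_def of_bool_def)
    moreover have "\<delta> u + A \<ge> 1"
      using \<mu>_pos[OF u(2)] close[of u] uF A01 by (cases "\<mu> u = 1") (auto simp: \<delta>_def of_bool_def)
    ultimately show ?thesis using sum2[OF t(2) u(2) False] by linarith
  next
    case True
    then have \<delta>t: "\<delta> t = int (\<mu> t)" using tF uF by (simp add: \<delta>_def)
    show ?thesis
    proof (cases "\<mu> t = 1")
      case False
      then show ?thesis using \<delta>t \<mu>_pos[OF t(2)] sum1[OF t(2)] A01 by linarith
    next
      case True
      have "\<exists>v\<in>?L - {t}. odd (\<mu> v)"
      proof (rule ccontr)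
        assume "\<not> ?thesis"
        then have "even (\<Sum>v\<in>?L - {t}. \<mu> v)" by (intro dvd_sum) auto
        moreover have "p = \<mu> t + (\<Sum>v\<in>?L - {t}. \<mu> v)"
          using p_sum sum.remove[OF fin t(2), of \<mu>] by simp
        ultimately show False using ev True by (metis even_add odd_one)
      qed
      then obtain v where v: "v \<in> ?L" "v \<noteq> t" "odd (\<mu> v)" by blast
      have "\<delta> v + A + A' \<ge> 1" using one[OF v(1)] v(3) by blast
      then show ?thesis using \<delta>t True sum2[OF t(2) v(1)] v(2) by simp
    qed
  qed
  then show "freedom p J pos U j + freedom p J pos' U j \<le> p" using free by linarith
qed

text \<open>
  For a fixed pattern, the numbers of free vertices in a reading and in its reverse add up to at most
  \<open>k * (p + 1) - 1\<close>. The geometric mean of the two bounds has half this exponent, which explains the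
  square root. The power of \<open>k * p\<close> bounds the number of patterns.
\<close>

lemma card_branching_families_le:
  fixes L :: "nat \<Rightarrow> nat \<Rightarrow> 'i"
  assumes p: "0 < p" "even p" and N: "1 \<le> N" and B: "1 \<le> B"
    and bound: "\<And>i t. i < N \<Longrightarrow> card {l. l < N \<and> L i l = t} \<le> B"
  shows "real (card {C \<in> PiE {..<k} (\<lambda>_. circuits p N).
            essential p {..<k} (\<lambda>j. word p L (C j)) \<and> branching p {..<k} (\<lambda>j. word p L (C j))})
         \<le> real ((k * p) ^ (k * p) * B ^ (p * k)) * sqrt (real N ^ (k * (p + 1) - 1))"
    (is "real (card ?Bad) \<le> _")
proof -
  define E where "E = {..<k} \<times> {..<p}"
  define X where "X P = {C \<in> PiE {..<k} (\<lambda>_. circuits p N).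
            \<forall>j\<in>{..<k}. \<forall>s<p. \<forall>j'\<in>{..<k}. \<forall>s'<p. curry P j s = curry P j' s' \<longrightarrow>
              word p L (C j) s = word p L (C j') s'}" for P :: "nat \<times> nat \<Rightarrow> nat \<times> nat"
  define patterns where "patterns =
    {P \<in> PiE E (\<lambda>_. E). essential p {..<k} (curry P) \<and> branching p {..<k} (curry P)}"
  have finE: "finite (PiE E (\<lambda>_. E))" by (simp add: E_def finite_PiE)
  have "card patterns \<le> card (PiE E (\<lambda>_. E))"
    unfolding patterns_def using finE by (intro card_mono) auto
  also have "\<dots> = (k * p) ^ (k * p)" by (simp add: card_PiE E_def)
  finally have card_patterns: "card patterns \<le> (k * p) ^ (k * p)" .
  have finp: "finite patterns" using finE by (simp add: patterns_def)
  have finX: "finite (X P)" for P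
    unfolding X_def by (rule finite_subset[OF _ finite_PiE[of "{..<k}" "\<lambda>_. circuits p N"]]) auto
  have sub: "?Bad \<subseteq> (\<Union>P\<in>patterns. X P)"
  proof
    fix C assume C: "C \<in> ?Bad"
    \<comment> \<open>a pattern sends every position to a chosen position with the same letter\<close>
    define w where "w = (\<lambda>(j, s). word p L (C j) s)"
    define P where "P = restrict (\<lambda>e. SOME e'. e' \<in> E \<and> w e' = w e) E"
    have P: "P e \<in> E \<and> w (P e) = w e" if "e \<in> E" for e
      using someI[of "\<lambda>e'. e' \<in> E \<and> w e' = w e" e] that by (simp add: P_def)
    have P_eq: "P e = P e' \<longleftrightarrow> w e = w e'" if "e \<in> E" "e' \<in> E" for e e'
    proof
      assume "P e = P e'" then show "w e = w e'" using P that by metis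
    qed (use that in \<open>simp add: P_def\<close>)
    have eq: "curry P j s = curry P j' s' \<longleftrightarrow> word p L (C j) s = word p L (C j') s'"
      if "j < k" "s < p" "j' < k" "s' < p" for j s j' s'
      using P_eq[of "(j, s)" "(j', s')"] that by (simp add: E_def w_def)
    have "essential p {..<k} (curry P)" "branching p {..<k} (curry P)"
      using C essential_branching_cong[of "{..<k}" p "curry P" "\<lambda>j. word p L (C j)"] eq
      by (simp_all only: mem_Collect_eq lessThan_iff)
    moreover have "P \<in> PiE E (\<lambda>_. E)" using P by (auto simp: P_def)
    moreover have "C \<in> X P" using C eq by (auto simp: X_def)
    ultimately show "C \<in> (\<Union>P\<in>patterns. X P)" by (auto simp: patterns_def)
  qed
  have each: "real (card (X P)) \<le> real (B ^ (p * k)) * sqrt (real N ^ (k * (p + 1) - 1))"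
    if "P \<in> patterns" for P
  proof -
    have ess: "essential p {..<k} (curry P)" and br: "branching p {..<k} (curry P)"
      using that by (auto simp: patterns_def)
    from br obtain j i l where jil: "j < k" "i < k" "l < k" "i \<noteq> j" "l \<noteq> j" "i \<noteq> l"
      "letters p (curry P i) \<inter> letters p (curry P j) \<noteq> {}"
      "letters p (curry P l) \<inter> letters p (curry P j) \<noteq> {}"
      unfolding branching_def by auto
    \<comment> \<open>an order in which \<open>i\<close> comes first and \<open>l\<close> last, so that \<open>j\<close> lies between its neighbours\<close>
    define pos where "pos a = (if a = i then 0 else if a = l then k + 2 else Suc a)" for a
    define pos' where "pos' a = k + 2 - pos a" for a
    have inj: "inj_on pos {..<k}" by (auto simp: inj_on_def pos_def)
    have pos_le: "pos a \<le> k + 2" if "a < k" for a using that by (auto simp: pos_def)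
    have rev: "pos' a < pos' c \<longleftrightarrow> pos c < pos a" if "a \<in> {..<k}" "c \<in> {..<k}" for a c
      using pos_le[of a] pos_le[of c] that by (auto simp: pos'_def)
    have inj': "inj_on pos' {..<k}"
      using inj pos_le unfolding inj_on_def pos'_def by (metis diff_diff_cancel lessThan_iff)
    let ?f = "freedom p {..<k} pos (curry P)" and ?f' = "freedom p {..<k} pos' (curry P)"
    have c: "card (X P) \<le> B ^ (p * k) * N ^ sum ?f {..<k}"
      using card_circuit_families_le[OF p(1) N B finite_lessThan inj bound, where \<kappa> = "curry P"]
      by (simp add: X_def)
    have c': "card (X P) \<le> B ^ (p * k) * N ^ sum ?f' {..<k}"
      using card_circuit_families_le[OF p(1) N B finite_lessThan inj' bound, where \<kappa> = "curry P"]
      by (simp add: X_def)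
    have "pos i < pos j" "pos j < pos l" using jil by (auto simp: pos_def)
    then have jle: "?f j + ?f' j \<le> p"
      using freedom_add_reverse(2)[OF inj rev ess _ p(2), of j i l] jil by auto
    have "(\<Sum>a<k. ?f a + ?f' a) = (?f j + ?f' j) + (\<Sum>a\<in>{..<k} - {j}. ?f a + ?f' a)"
      using jil by (intro sum.remove) auto
    also have "(\<Sum>a\<in>{..<k} - {j}. ?f a + ?f' a) \<le> (\<Sum>a\<in>{..<k} - {j}. p + 1)"
      using freedom_add_reverse(1)[OF inj rev ess] by (intro sum_mono) auto
    also have "\<dots> = (k - 1) * (p + 1)" using jil by simp
    finally have "sum ?f {..<k} + sum ?f' {..<k} \<le> p + (k - 1) * (p + 1)"
      unfolding sum.distrib using jle by linarith
    also have "\<dots> = k * (p + 1) - 1" using jil by (cases k) auto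
    finally have d: "sum ?f {..<k} + sum ?f' {..<k} \<le> k * (p + 1) - 1" .
    have "card (X P) ^ 2 \<le> (B ^ (p * k) * N ^ sum ?f {..<k}) * (B ^ (p * k) * N ^ sum ?f' {..<k})"
      unfolding power2_eq_square using c c' by (rule mult_le_mono)
    also have "\<dots> = (B ^ (p * k))\<^sup>2 * N ^ (sum ?f {..<k} + sum ?f' {..<k})"
      by (simp add: power_add power2_eq_square)
    also have "\<dots> \<le> (B ^ (p * k))\<^sup>2 * N ^ (k * (p + 1) - 1)"
      using d N by (intro mult_le_mono2 power_increasing) auto
    finally have "real (card (X P) ^ 2) \<le> real ((B ^ (p * k))\<^sup>2 * N ^ (k * (p + 1) - 1))"
      by (rule of_nat_mono)
    then have "real (card (X P)) \<le> sqrt ((real (B ^ (p * k)))\<^sup>2 * real N ^ (k * (p + 1) - 1))"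
      by (intro real_le_rsqrt) (simp only: of_nat_mult of_nat_power)
    then show ?thesis by (simp add: real_sqrt_mult)
  qed
  have "card ?Bad \<le> card (\<Union>P\<in>patterns. X P)"
    using sub finp finX by (intro card_mono) auto
  also have "\<dots> \<le> (\<Sum>P\<in>patterns. card (X P))" by (rule card_UN_le[OF finp])
  finally have "real (card ?Bad) \<le> real (\<Sum>P\<in>patterns. card (X P))"
    by (rule of_nat_mono)
  also have "\<dots> = (\<Sum>P\<in>patterns. real (card (X P)))" by (rule of_nat_sum)
  also have "\<dots> \<le> real (card patterns) * (real (B ^ (p * k)) * sqrt (real N ^ (k * (p + 1) - 1)))"
    using each by (rule sum_bounded_above)
  also have "\<dots> \<le> real ((k * p) ^ (k * p)) * (real (B ^ (p * k)) * sqrt (real N ^ (k * (p + 1) - 1)))"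
    using card_patterns by (intro mult_right_mono of_nat_mono) auto
  finally show ?thesis by (simp only: of_nat_mult mult.assoc)
qed

section \<open>The method of moments for the normal law\<close>

lemma std_normal_moment_recurrence:
  "(LINT x|std_normal_distribution. x ^ (k + 2)) = real (k + 1) * (LINT x|std_normal_distribution. x ^ k)"
proof (cases "even k")
  case True
  then obtain j where j: "k = 2 * j" by (auto elim: evenE)
  have "(LINT x|std_normal_distribution. x ^ (k + 2)) = fact (2 * Suc j) / (2 ^ Suc j * fact (Suc j))"
    using std_normal_distribution_even_moments(1)[of "Suc j"] by (simp add: j)
  also have "\<dots> = (2 * real (j + 1)) * real (k + 1) * fact (2 * j) / ((2 * 2 ^ j) * (real (j + 1) * fact j))"
    by (simp add: j algebra_simps)
  also have "\<dots> = real (k + 1) * (fact (2 * j) / (2 ^ j * fact j))"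
  proof -
    have "(2 * a) * b * F / ((2 * P) * (a * G)) = b * (F / (P * G))" if "a \<noteq> 0" for a b F P G :: real
      using that by simp
    then show ?thesis by (metis of_nat_neq_0 Suc_eq_plus1)
  qed
  finally show ?thesis using std_normal_distribution_even_moments(1)[of j] by (simp add: j)
next
  case False
  then show ?thesis
    using integral_std_normal_distribution_moment_odd[of k] integral_std_normal_distribution_moment_odd[of "k + 2"]
    by simp
qed

text \<open>
  The Taylor polynomial of degree \<open>2 * m\<close> of a characteristic function at \<open>0\<close> involves only moments,
  and its error is at most \<open>2 * \<bar>t\<bar> ^ (2 * m) / fact (2 * m)\<close> times the moment of order \<open>2 * m\<close>. For the
  normal law this is \<open>2 * (t\<^sup>2 / 2) ^ m / fact m\<close>, which is small for large \<open>m\<close>; for such a fixed \<open>m\<close> it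
  is then small along the sequence too.
\<close>

lemma weak_conv_m_std_normal_of_moments:
  fixes \<mu> :: "nat \<Rightarrow> real measure"
  assumes rd: "\<And>n. real_distribution (\<mu> n)"
    and int: "\<And>n k. integrable (\<mu> n) (\<lambda>x. x ^ k)"
    and lim: "\<And>k. (\<lambda>n. LINT x|\<mu> n. x ^ k) \<longlonglongrightarrow> (LINT x|std_normal_distribution. x ^ k)"
  shows "weak_conv_m \<mu> std_normal_distribution"
proof (rule levy_continuity[OF rd])
  show std: "real_distribution std_normal_distribution" by (rule real_dist_normal_dist)
  fix t :: real
  let ?\<nu> = std_normal_distribution
  define P where "P \<rho> m = (\<Sum>k\<le>2 * m. ((\<i> * t) ^ k / fact k) * complex_of_real (LINT x|\<rho>. x ^ k))" for \<rho> :: "real measure" and m :: nat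
  define R where "R m = 2 * \<bar>t\<bar> ^ (2 * m) / fact (2 * m)" for m :: nat
  have approx: "cmod (char \<rho> t - P \<rho> m) \<le> R m * (LINT x|\<rho>. x ^ (2 * m))"
    if "real_distribution \<rho>" "\<And>k. integrable \<rho> (\<lambda>x. x ^ k)" for \<rho> m
    using real_distribution.char_approx1[OF that(1), of "2 * m" t] that(2)
    by (simp add: P_def R_def power_even_abs)
  have abs_t: "\<bar>t\<bar> ^ (2 * m) = (t\<^sup>2) ^ m" for m by (simp only: power_mult power2_abs)
  have R_lim: "(\<lambda>m. R m * (LINT x|?\<nu>. x ^ (2 * m))) \<longlonglongrightarrow> 0"
  proof -
    have "R m * (LINT x|?\<nu>. x ^ (2 * m)) = 2 * (inverse (fact m) * (t\<^sup>2 / 2) ^ m)" for m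
      unfolding std_normal_distribution_even_moments R_def abs_t
      by (simp add: power_divide field_simps)
    moreover have "(\<lambda>m. inverse (fact m) * (t\<^sup>2 / 2) ^ m) \<longlonglongrightarrow> 0"
      using summable_exp[of "t\<^sup>2 / 2"] by (rule summable_LIMSEQ_zero)
    ultimately show ?thesis by (simp add: tendsto_mult_right_zero)
  qed
  have P_lim: "(\<lambda>n. P (\<mu> n) m) \<longlonglongrightarrow> P ?\<nu> m" for m
    unfolding P_def by (intro tendsto_intros lim)
  show "(\<lambda>n. char (\<mu> n) t) \<longlonglongrightarrow> char ?\<nu> t"
  proof (rule tendstoI)
    fix e :: real assume e: "e > 0"
    then have "eventually (\<lambda>m. R m * (LINT x|?\<nu>. x ^ (2 * m)) < e / 4) sequentially"
      using order_tendstoD(2)[OF R_lim, of "e / 4"] by simp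
    then obtain m where m: "R m * (LINT x|?\<nu>. x ^ (2 * m)) < e / 4"
      by (auto simp: eventually_sequentially)
    have "(\<lambda>n. R m * (LINT x|\<mu> n. x ^ (2 * m))) \<longlonglongrightarrow> R m * (LINT x|?\<nu>. x ^ (2 * m))"
      by (intro tendsto_intros lim)
    then have "eventually (\<lambda>n. R m * (LINT x|\<mu> n. x ^ (2 * m)) < e / 4) sequentially"
      using m by (rule order_tendstoD(2))
    moreover have "eventually (\<lambda>n. dist (P (\<mu> n) m) (P ?\<nu> m) < e / 4) sequentially"
      using P_lim e by (intro tendstoD) auto
    ultimately show "eventually (\<lambda>n. dist (char (\<mu> n) t) (char ?\<nu> t) < e) sequentially"
    proof eventually_elim
      case (elim n)
      have "dist (char (\<mu> n) t) (char ?\<nu> t) \<le> dist (char (\<mu> n) t) (P (\<mu> n) m)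
          + dist (P (\<mu> n) m) (P ?\<nu> m) + dist (P ?\<nu> m) (char ?\<nu> t)"
        using dist_triangle[of "char (\<mu> n) t" "char ?\<nu> t" "P (\<mu> n) m"]
          dist_triangle[of "P (\<mu> n) m" "char ?\<nu> t" "P ?\<nu> m"] by linarith
      moreover have "dist (char (\<mu> n) t) (P (\<mu> n) m) \<le> R m * (LINT x|\<mu> n. x ^ (2 * m))"
        using approx[OF rd int] by (simp add: dist_norm)
      moreover have "dist (P ?\<nu> m) (char ?\<nu> t) \<le> R m * (LINT x|?\<nu>. x ^ (2 * m))"
        using approx[OF std integrable_std_normal_distribution_moment] by (simp add: dist_norm norm_minus_commute)
      ultimately show ?case using elim m e by linarith
    qed
  qed
qed

text \<open>
  The recurrence \<open>m k = (k - 1) * m (k - 2)\<close> determines the moments of the standard normal law; here it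
  is only required in the limit.
\<close>

lemma std_normal_moment_limit:
  fixes m :: "nat \<Rightarrow> nat \<Rightarrow> real"
  assumes "m 0 \<longlonglongrightarrow> 1" "m 1 \<longlonglongrightarrow> 0"
    and rec: "\<And>k. 2 \<le> k \<Longrightarrow> (\<lambda>n. m k n - real (k - 1) * m (k - 2) n) \<longlonglongrightarrow> 0"
  shows "m k \<longlonglongrightarrow> (LINT x|std_normal_distribution. x ^ k)"
proof (induction k rule: less_induct)
  case (less k)
  consider "k = 0" | "k = 1" | j where "k = j + 2"
    by (metis One_nat_def add_2_eq_Suc' not0_implies_Suc)
  then show ?case
  proof cases
    case 1
    then show ?thesis using assms(1) std_normal_distribution_even_moments(1)[of 0] by simp
  next
    case 2
    then show ?thesis using assms(2) integral_std_normal_distribution_moment_odd[of 1] by simp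
  next
    case 3
    have "(\<lambda>n. (m k n - real (k - 1) * m j n) + real (k - 1) * m j n)
        \<longlonglongrightarrow> 0 + real (k - 1) * (LINT x|std_normal_distribution. x ^ j)"
      using rec[of k] less[of j] 3 by (intro tendsto_intros) auto
    then show ?thesis using std_normal_moment_recurrence[of j] 3 by simp
  qed
qed

section \<open>Random variables with moments of all orders\<close>

text \<open>
  The product is at most the corresponding power of the largest factor. This crude substitute for
  Hoelder's inequality suffices wherever only the existence of a uniform bound matters.
\<close>

lemma prod_le_sum_power:
  fixes z :: "'b \<Rightarrow> real"
  assumes "finite I" "I \<noteq> {}" and nn: "\<And>i. i \<in> I \<Longrightarrow> 0 \<le> z i"
  shows "(\<Prod>i\<in>I. z i) \<le> (\<Sum>i\<in>I. z i ^ card I)"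
proof -
  obtain m where m: "m \<in> I" "Max (z ` I) = z m"
    using Max_in[of "z ` I"] assms(1,2) by (metis (no_types, lifting) finite_imageI image_iff image_is_empty)
  have "(\<Prod>i\<in>I. z i) \<le> (\<Prod>i\<in>I. z m)"
    using nn m assms(1) by (intro prod_mono) (metis Max_ge finite_imageI imageI)
  also have "\<dots> = z m ^ card I" by simp
  also have "\<dots> \<le> (\<Sum>i\<in>I. z i ^ card I)"
    using nn m assms(1) by (intro member_le_sum) auto
  finally show ?thesis .
qed

lemma abs_diff_power_le:
  fixes a b :: real
  shows "\<bar>a - b\<bar> ^ k \<le> 2 ^ k * (\<bar>a\<bar> ^ k + \<bar>b\<bar> ^ k)"
proof -
  have "\<bar>a - b\<bar> ^ k \<le> (2 * max \<bar>a\<bar> \<bar>b\<bar>) ^ k" by (intro power_mono) auto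
  also have "\<dots> \<le> 2 ^ k * (\<bar>a\<bar> ^ k + \<bar>b\<bar> ^ k)"
    by (simp add: power_mult_distrib max_def)
  finally show ?thesis .
qed

context prob_space begin

text \<open>
  A class closed under sums and products, so that integrability holds for every polynomial in the
  inputs.
\<close>

definition all_moments :: "('a \<Rightarrow> real) \<Rightarrow> bool" where
  "all_moments X \<longleftrightarrow> X \<in> borel_measurable M \<and> (\<forall>k::nat. integrable M (\<lambda>\<omega>. \<bar>X \<omega>\<bar> ^ k))"

lemma all_moments_measurable: "all_moments X \<Longrightarrow> X \<in> borel_measurable M"
  by (simp add: all_moments_def)

lemma all_moments_integrable_power: "all_moments X \<Longrightarrow> integrable M (\<lambda>\<omega>. X \<omega> ^ k)"
proof -
  assume X: "all_moments X"
  then have [measurable]: "X \<in> borel_measurable M" by (rule all_moments_measurable)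
  have "integrable M (\<lambda>\<omega>. \<bar>X \<omega>\<bar> ^ k)" using X by (simp add: all_moments_def)
  then show ?thesis by (rule Bochner_Integration.integrable_bound) (auto simp: power_abs)
qed

lemma all_moments_integrable: "all_moments X \<Longrightarrow> integrable M X"
  using all_moments_integrable_power[of X 1] by simp

lemma all_moments_const: "all_moments (\<lambda>_. c)"
  by (simp add: all_moments_def)

lemma all_moments_mult:
  assumes X: "all_moments X" and Y: "all_moments Y"
  shows "all_moments (\<lambda>\<omega>. X \<omega> * Y \<omega>)"
proof -
  have [measurable]: "X \<in> borel_measurable M" "Y \<in> borel_measurable M"
    using X Y by (auto simp: all_moments_def)
  have "integrable M (\<lambda>\<omega>. \<bar>X \<omega> * Y \<omega>\<bar> ^ k)" for k
  proof (rule Bochner_Integration.integrable_bound)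
    show "integrable M (\<lambda>\<omega>. \<bar>X \<omega>\<bar> ^ (2 * k) + \<bar>Y \<omega>\<bar> ^ (2 * k))"
      using X Y by (auto simp: all_moments_def)
    show "AE \<omega> in M. norm (\<bar>X \<omega> * Y \<omega>\<bar> ^ k) \<le> norm (\<bar>X \<omega>\<bar> ^ (2 * k) + \<bar>Y \<omega>\<bar> ^ (2 * k))"
    proof (rule AE_I2)
      fix \<omega>
      have "0 \<le> \<bar>X \<omega>\<bar> ^ k * \<bar>Y \<omega>\<bar> ^ k" by simp
      then have "\<bar>X \<omega>\<bar> ^ k * \<bar>Y \<omega>\<bar> ^ k \<le> (\<bar>X \<omega>\<bar> ^ k)\<^sup>2 + (\<bar>Y \<omega>\<bar> ^ k)\<^sup>2"
        using sum_squares_bound[of "\<bar>X \<omega>\<bar> ^ k" "\<bar>Y \<omega>\<bar> ^ k"] by linarith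
      then show "norm (\<bar>X \<omega> * Y \<omega>\<bar> ^ k) \<le> norm (\<bar>X \<omega>\<bar> ^ (2 * k) + \<bar>Y \<omega>\<bar> ^ (2 * k))"
        by (simp add: abs_mult power_mult_distrib power_even_eq)
    qed
  qed measurable
  then show ?thesis by (simp add: all_moments_def)
qed

lemma all_moments_diff:
  assumes X: "all_moments X" and Y: "all_moments Y"
  shows "all_moments (\<lambda>\<omega>. X \<omega> - Y \<omega>)"
proof -
  have [measurable]: "X \<in> borel_measurable M" "Y \<in> borel_measurable M"
    using X Y by (auto simp: all_moments_def)
  have "integrable M (\<lambda>\<omega>. \<bar>X \<omega> - Y \<omega>\<bar> ^ k)" for k
  proof (rule Bochner_Integration.integrable_bound)
    show "integrable M (\<lambda>\<omega>. 2 ^ k * (\<bar>X \<omega>\<bar> ^ k + \<bar>Y \<omega>\<bar> ^ k))"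
      using X Y by (auto simp: all_moments_def)
    show "AE \<omega> in M. norm (\<bar>X \<omega> - Y \<omega>\<bar> ^ k) \<le> norm (2 ^ k * (\<bar>X \<omega>\<bar> ^ k + \<bar>Y \<omega>\<bar> ^ k))"
      using abs_diff_power_le by (intro AE_I2) (simp add: abs_mult)
  qed measurable
  then show ?thesis by (simp add: all_moments_def)
qed

lemma all_moments_sum: "(\<And>i. i \<in> I \<Longrightarrow> all_moments (X i)) \<Longrightarrow> all_moments (\<lambda>\<omega>. \<Sum>i\<in>I. X i \<omega>)"
proof (induction I rule: infinite_finite_induct)
  case (insert i I)
  have "all_moments (\<lambda>\<omega>. X i \<omega> - (-1) * (\<Sum>i\<in>I. X i \<omega>))"
    using insert by (intro all_moments_diff all_moments_mult all_moments_const) auto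
  then show ?case using insert.hyps by simp
qed (simp_all add: all_moments_const)

lemma all_moments_prod: "(\<And>i. i \<in> I \<Longrightarrow> all_moments (X i)) \<Longrightarrow> all_moments (\<lambda>\<omega>. \<Prod>i\<in>I. X i \<omega>)"
proof (induction I rule: infinite_finite_induct)
  case (insert i I)
  then show ?case by (simp add: all_moments_mult)
qed (simp_all add: all_moments_const)

text \<open>
  The factorisations of \<open>F\<close> and \<open>G\<close> through the restricted families are explicit parameters, since for
  polynomials in the inputs they can simply be written down.
\<close>

lemma expectation_mult_disjoint:
  fixes f g :: "('i \<Rightarrow> real) \<Rightarrow> real"
  assumes "indep_vars (\<lambda>_. borel) x UNIV" "A \<inter> B = {}"
    and f: "f \<in> borel_measurable (PiM A (\<lambda>_. borel))" and g: "g \<in> borel_measurable (PiM B (\<lambda>_. borel))"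
    and F: "\<And>\<omega>. F \<omega> = f (restrict (\<lambda>i. x i \<omega>) A)" and G: "\<And>\<omega>. G \<omega> = g (restrict (\<lambda>i. x i \<omega>) B)"
    and "integrable M F" "integrable M G"
  shows "expectation (\<lambda>\<omega>. F \<omega> * G \<omega>) = expectation F * expectation G"
proof -
  have "indep_var borel (f \<circ> (\<lambda>\<omega>. restrict (\<lambda>i. x i \<omega>) A)) borel (g \<circ> (\<lambda>\<omega>. restrict (\<lambda>i. x i \<omega>) B))"
    using assms by (intro indep_var_compose[OF indep_var_restrict[where I = UNIV] f g]) auto
  then have "indep_var borel F borel G" by (simp add: comp_def flip: F G)
  then show ?thesis using assms by (intro indep_var_lebesgue_integral)
qed

end

section \<open>Joint moments of centred words\<close>

locale independent_field = prob_space M for M :: "'w measure" +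
  fixes x :: "'i \<Rightarrow> 'w \<Rightarrow> real"
  assumes indep: "indep_vars (\<lambda>_. borel) x UNIV"
    and mean: "\<And>i. expectation (x i) = 0"
    and moments: "\<And>k::nat. (SUP i. \<integral>\<^sup>+ \<omega>. ennreal (\<bar>x i \<omega>\<bar> ^ k) \<partial>M) < \<infinity>"
begin

definition moment_bound :: "nat \<Rightarrow> real" where
  "moment_bound k = enn2real (SUP i. \<integral>\<^sup>+ \<omega>. ennreal (\<bar>x i \<omega>\<bar> ^ k) \<partial>M)"

lemma measurable_entry [measurable]: "x i \<in> borel_measurable M"
  using indep by (auto simp: indep_vars_def)

lemma entry_moments:
  shows all_moments_entry: "all_moments (x i)"
    and expectation_entry_le: "expectation (\<lambda>\<omega>. \<bar>x i \<omega>\<bar> ^ k) \<le> moment_bound k"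
proof -
  have le: "(\<integral>\<^sup>+ \<omega>. ennreal (\<bar>x i \<omega>\<bar> ^ k) \<partial>M) \<le> (SUP i. \<integral>\<^sup>+ \<omega>. ennreal (\<bar>x i \<omega>\<bar> ^ k) \<partial>M)" for k
    by (rule SUP_upper) simp
  have "integrable M (\<lambda>\<omega>. \<bar>x i \<omega>\<bar> ^ k)" for k
    by (rule integrableI_bounded) (use le_less_trans[OF le moments] in auto)
  then show "all_moments (x i)" by (simp add: all_moments_def)
  have "expectation (\<lambda>\<omega>. \<bar>x i \<omega>\<bar> ^ k) = enn2real (\<integral>\<^sup>+ \<omega>. ennreal (\<bar>x i \<omega>\<bar> ^ k) \<partial>M)"
    by (rule integral_eq_nn_integral) auto
  also have "\<dots> \<le> moment_bound k"
    unfolding moment_bound_def using le moments by (intro enn2real_mono) auto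
  finally show "expectation (\<lambda>\<omega>. \<bar>x i \<omega>\<bar> ^ k) \<le> moment_bound k" .
qed

definition word_value :: "nat \<Rightarrow> (nat \<Rightarrow> 'i) \<Rightarrow> 'w \<Rightarrow> real" where
  "word_value p u \<omega> = (\<Prod>s<p. x (u s) \<omega>)"

definition centred_word :: "nat \<Rightarrow> (nat \<Rightarrow> 'i) \<Rightarrow> 'w \<Rightarrow> real" where
  "centred_word p u \<omega> = word_value p u \<omega> - expectation (word_value p u)"

definition joint_moment :: "nat \<Rightarrow> nat set \<Rightarrow> (nat \<Rightarrow> nat \<Rightarrow> 'i) \<Rightarrow> real" where
  "joint_moment p J U = expectation (\<lambda>\<omega>. \<Prod>j\<in>J. centred_word p (U j) \<omega>)"

lemma all_moments_word_value: "all_moments (word_value p u)"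
  unfolding word_value_def by (intro all_moments_prod all_moments_entry)

lemma all_moments_centred_word: "all_moments (centred_word p u)"
  unfolding centred_word_def by (intro all_moments_diff all_moments_word_value all_moments_const)

lemma expectation_centred_word [simp]: "expectation (centred_word p u) = 0"
  unfolding centred_word_def
  using all_moments_integrable[OF all_moments_word_value] by (simp add: prob_space)

lemma word_value_moment_le:
  assumes "0 < p"
  shows "expectation (\<lambda>\<omega>. \<bar>word_value p u \<omega>\<bar> ^ k) \<le> real p * moment_bound (k * p)"
proof -
  have int: "integrable M (\<lambda>\<omega>. \<bar>x i \<omega>\<bar> ^ k)" for i k
    using all_moments_entry by (simp add: all_moments_def)
  have "expectation (\<lambda>\<omega>. \<bar>word_value p u \<omega>\<bar> ^ k) \<le> expectation (\<lambda>\<omega>. \<Sum>s<p. \<bar>x (u s) \<omega>\<bar> ^ (k * p))"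
  proof (rule integral_mono)
    show "integrable M (\<lambda>\<omega>. \<bar>word_value p u \<omega>\<bar> ^ k)"
      using all_moments_word_value by (simp add: all_moments_def)
    show "integrable M (\<lambda>\<omega>. \<Sum>s<p. \<bar>x (u s) \<omega>\<bar> ^ (k * p))" using int by auto
    fix \<omega>
    show "\<bar>word_value p u \<omega>\<bar> ^ k \<le> (\<Sum>s<p. \<bar>x (u s) \<omega>\<bar> ^ (k * p))"
      using prod_le_sum_power[of "{..<p}" "\<lambda>s. \<bar>x (u s) \<omega>\<bar> ^ k"] assms
      by (simp add: word_value_def abs_prod prod_power_distrib power_mult lessThan_empty_iff)
  qed
  also have "\<dots> = (\<Sum>s<p. expectation (\<lambda>\<omega>. \<bar>x (u s) \<omega>\<bar> ^ (k * p)))"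
    using int by (intro Bochner_Integration.integral_sum) auto
  also have "\<dots> \<le> real p * moment_bound (k * p)"
    using sum_bounded_above[of "{..<p}" "\<lambda>s. expectation (\<lambda>\<omega>. \<bar>x (u s) \<omega>\<bar> ^ (k * p))"]
      expectation_entry_le by simp
  finally show ?thesis .
qed

text \<open>
  The bound \<open>K\<close> depends on the number of words and their length only, not on the letters; this
  uniformity is what the bounded moments of the inputs are for.
\<close>

lemma joint_moment_bounded:
  assumes p: "0 < p"
  obtains K where "0 \<le> K" "\<And>J U. finite J \<Longrightarrow> card J = k \<Longrightarrow> \<bar>joint_moment p J U\<bar> \<le> K"
proof -
  define c where "c = real p * moment_bound p"
  define K where "K = 1 + real k * (2 ^ k * (real p * moment_bound (k * p) + c ^ k))"
  have mean_le: "\<bar>expectation (word_value p u)\<bar> \<le> c" for u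
  proof -
    have "\<bar>expectation (word_value p u)\<bar> \<le> expectation (\<lambda>\<omega>. \<bar>word_value p u \<omega>\<bar> ^ 1)"
      using integral_abs_bound[of M "word_value p u"] by simp
    also have "\<dots> \<le> c" using word_value_moment_le[OF p, of u 1] by (simp add: c_def)
    finally show ?thesis .
  qed
  have int: "integrable M (\<lambda>\<omega>. \<bar>centred_word p u \<omega>\<bar> ^ k)" "integrable M (\<lambda>\<omega>. \<bar>word_value p u \<omega>\<bar> ^ k)" for u k
    using all_moments_centred_word all_moments_word_value by (auto simp: all_moments_def)
  have mb: "moment_bound m \<ge> 0" for m by (simp add: moment_bound_def)
  have one: "expectation (\<lambda>\<omega>. \<bar>centred_word p u \<omega>\<bar> ^ k) \<le> 2 ^ k * (real p * moment_bound (k * p) + c ^ k)" for u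
  proof -
    let ?e = "expectation (word_value p u)"
    have "expectation (\<lambda>\<omega>. \<bar>centred_word p u \<omega>\<bar> ^ k)
        \<le> expectation (\<lambda>\<omega>. 2 ^ k * (\<bar>word_value p u \<omega>\<bar> ^ k + \<bar>?e\<bar> ^ k))"
      using int abs_diff_power_le by (intro integral_mono) (auto simp: centred_word_def)
    also have "\<dots> = 2 ^ k * (expectation (\<lambda>\<omega>. \<bar>word_value p u \<omega>\<bar> ^ k) + \<bar>?e\<bar> ^ k)"
      using int by (simp add: prob_space)
    also have "\<dots> \<le> 2 ^ k * (real p * moment_bound (k * p) + c ^ k)"
      using word_value_moment_le[OF p] mean_le by (intro mult_left_mono add_mono power_mono) auto
    finally show ?thesis .
  qed
  have c0: "0 \<le> c" using mb by (simp add: c_def)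
  show ?thesis
  proof
    show "0 \<le> K" using mb c0 by (simp add: K_def)
    fix J :: "nat set" and U :: "nat \<Rightarrow> nat \<Rightarrow> 'i" assume J: "finite J" "card J = k"
    show "\<bar>joint_moment p J U\<bar> \<le> K"
    proof (cases "J = {}")
      case True
      then show ?thesis using J by (simp add: joint_moment_def K_def prob_space)
    next
      case False
      have "\<bar>joint_moment p J U\<bar> \<le> expectation (\<lambda>\<omega>. \<bar>\<Prod>j\<in>J. centred_word p (U j) \<omega>\<bar>)"
        unfolding joint_moment_def by (rule integral_abs_bound)
      also have "\<dots> \<le> expectation (\<lambda>\<omega>. \<Sum>j\<in>J. \<bar>centred_word p (U j) \<omega>\<bar> ^ k)"
      proof (rule integral_mono)
        show "integrable M (\<lambda>\<omega>. \<bar>\<Prod>j\<in>J. centred_word p (U j) \<omega>\<bar>)"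
          using all_moments_centred_word by (intro integrable_abs all_moments_integrable all_moments_prod)
        show "integrable M (\<lambda>\<omega>. \<Sum>j\<in>J. \<bar>centred_word p (U j) \<omega>\<bar> ^ k)" using int by auto
        fix \<omega>
        show "\<bar>\<Prod>j\<in>J. centred_word p (U j) \<omega>\<bar> \<le> (\<Sum>j\<in>J. \<bar>centred_word p (U j) \<omega>\<bar> ^ k)"
          using prod_le_sum_power[OF J(1) False, of "\<lambda>j. \<bar>centred_word p (U j) \<omega>\<bar>"] J(2)
          by (simp add: abs_prod)
      qed
      also have "\<dots> = (\<Sum>j\<in>J. expectation (\<lambda>\<omega>. \<bar>centred_word p (U j) \<omega>\<bar> ^ k))"
        using int by (intro Bochner_Integration.integral_sum) auto
      also have "\<dots> \<le> real (card J) * (2 ^ k * (real p * moment_bound (k * p) + c ^ k))"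
        using one by (rule sum_bounded_above)
      also have "\<dots> \<le> K" using J(2) by (simp add: K_def)
      finally show ?thesis .
    qed
  qed
qed

lemma measurable_word_polynomial:
  assumes "\<And>j. j \<in> J \<Longrightarrow> letters p (U j) \<subseteq> A"
  shows "(\<lambda>y. \<Prod>j\<in>J. (\<Prod>s<p. y (U j s)) - e j) \<in> borel_measurable (PiM A (\<lambda>_. borel :: real measure))"
proof (intro borel_measurable_prod borel_measurable_diff borel_measurable_const)
  fix j s assume "j \<in> J" "s \<in> {..<p}"
  then have "U j s \<in> A" using assms by (auto simp: letters_def)
  then show "(\<lambda>y. y (U j s)) \<in> borel_measurable (PiM A (\<lambda>_. borel :: real measure))"
    by (rule measurable_component_singleton)
qed

lemma joint_moment_split:
  assumes fin: "finite I" "finite J" and IJ: "I \<inter> J = {}"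
    and disj: "\<And>i j. i \<in> I \<Longrightarrow> j \<in> J \<Longrightarrow> letters p (U i) \<inter> letters p (U j) = {}"
  shows "joint_moment p (I \<union> J) U = joint_moment p I U * joint_moment p J U"
proof -
  let ?A = "\<lambda>I. \<Union>j\<in>I. letters p (U j)"
  let ?P = "\<lambda>I y. \<Prod>j\<in>I. (\<Prod>s<p. y (U j s)) - expectation (word_value p (U j))"
  have "expectation (\<lambda>\<omega>. (\<Prod>j\<in>I. centred_word p (U j) \<omega>) * (\<Prod>j\<in>J. centred_word p (U j) \<omega>))
      = expectation (\<lambda>\<omega>. \<Prod>j\<in>I. centred_word p (U j) \<omega>) * expectation (\<lambda>\<omega>. \<Prod>j\<in>J. centred_word p (U j) \<omega>)"
  proof (rule expectation_mult_disjoint[OF indep, of "?A I" "?A J"])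
    show "?A I \<inter> ?A J = {}" using disj by auto
    show "?P I \<in> borel_measurable (PiM (?A I) (\<lambda>_. borel))" "?P J \<in> borel_measurable (PiM (?A J) (\<lambda>_. borel))"
      by (rule measurable_word_polynomial; blast)+
    fix \<omega>
    show "(\<Prod>j\<in>I. centred_word p (U j) \<omega>) = ?P I (restrict (\<lambda>i. x i \<omega>) (?A I))"
      "(\<Prod>j\<in>J. centred_word p (U j) \<omega>) = ?P J (restrict (\<lambda>i. x i \<omega>) (?A J))"
      by (auto simp: centred_word_def word_value_def letters_def intro!: prod.cong arg_cong2[of _ _ _ _ "(-)"])
         (metis imageI lessThan_iff)+
  qed (intro all_moments_integrable all_moments_prod all_moments_centred_word)+
  then show ?thesis
    unfolding joint_moment_def using fin IJ by (simp add: prod.union_disjoint)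
qed

text \<open>
  The input at a letter that occurs only once splits off as an independent factor of mean zero. The
  word that contains this letter has expectation zero for the same reason, so centring it does not
  spoil the factorisation.
\<close>

lemma joint_moment_unique_letter:
  assumes J: "finite J" "j \<in> J" and s: "s < p"
    and unique: "\<And>j' s'. j' \<in> J \<Longrightarrow> s' < p \<Longrightarrow> U j' s' = U j s \<Longrightarrow> (j', s') = (j, s)"
  shows "joint_moment p J U = 0"
proof -
  let ?t = "U j s" and ?S = "{..<p} - {s}"
  let ?R = "\<lambda>\<omega>. \<Prod>s'\<in>?S. x (U j s') \<omega>"
  let ?Q = "\<lambda>\<omega>. \<Prod>i\<in>J - {j}. centred_word p (U i) \<omega>"
  define A where "A = U j ` ?S \<union> (\<Union>i\<in>J - {j}. letters p (U i))"
  have "?t \<noteq> U j s'" if "s' \<in> ?S" for s' using unique[OF J(2), of s'] that by fastforce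
  moreover have "?t \<noteq> U i s'" if "i \<in> J - {j}" "s' < p" for i s' using unique[of i s'] that by fastforce
  ultimately have tA: "{?t} \<inter> A = {}" unfolding A_def letters_def by blast
  have word: "word_value p (U j) \<omega> = x ?t \<omega> * ?R \<omega>" for \<omega>
    using s by (simp add: word_value_def prod.remove)
  have PR: "(\<lambda>y. \<Prod>s'\<in>?S. y (U j s')) \<in> borel_measurable (PiM A (\<lambda>_. borel :: real measure))"
    by (intro borel_measurable_prod measurable_component_singleton) (auto simp: A_def)
  have PQ: "(\<lambda>y. \<Prod>i\<in>J - {j}. (\<Prod>s<p. y (U i s)) - expectation (word_value p (U i)))
      \<in> borel_measurable (PiM A (\<lambda>_. borel :: real measure))"
    by (rule measurable_word_polynomial) (auto simp: A_def)
  have R: "?R \<omega> = (\<Prod>s'\<in>?S. restrict (\<lambda>i. x i \<omega>) A (U j s'))" for \<omega>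
    by (intro prod.cong) (auto simp: A_def)
  have Q: "?Q \<omega> = (\<Prod>i\<in>J - {j}. (\<Prod>s<p. restrict (\<lambda>i. x i \<omega>) A (U i s)) - expectation (word_value p (U i)))" for \<omega>
    by (auto simp: centred_word_def word_value_def letters_def A_def intro!: prod.cong arg_cong2[of _ _ _ _ "(-)"])
       (metis DiffI imageI lessThan_iff singletonD)
  have mt: "(\<lambda>y. y ?t) \<in> borel_measurable (PiM {?t} (\<lambda>_. borel :: real measure))"
    by (rule measurable_component_singleton) simp
  have amR: "all_moments ?R" and amQ: "all_moments ?Q"
    by (intro all_moments_prod all_moments_entry all_moments_centred_word)+
  have int_t: "integrable M (x ?t)" by (intro all_moments_integrable all_moments_entry)
  have "expectation (\<lambda>\<omega>. x ?t \<omega> * ?R \<omega>) = expectation (x ?t) * expectation ?R"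
    by (rule expectation_mult_disjoint[OF indep tA mt PR _ R int_t all_moments_integrable[OF amR]]) simp
  then have "expectation (word_value p (U j)) = 0" unfolding word by (simp add: mean)
  then have "(\<Prod>i\<in>J. centred_word p (U i) \<omega>) = x ?t \<omega> * (?R \<omega> * ?Q \<omega>)" for \<omega>
    using J by (simp add: prod.remove[of J j] centred_word_def word)
  then have "joint_moment p J U = expectation (\<lambda>\<omega>. x ?t \<omega> * (?R \<omega> * ?Q \<omega>))"
    by (simp add: joint_moment_def)
  also have "\<dots> = expectation (x ?t) * expectation (\<lambda>\<omega>. ?R \<omega> * ?Q \<omega>)"
    by (rule expectation_mult_disjoint[OF indep tA mt borel_measurable_times[OF PR PQ] _ _ int_t
          all_moments_integrable[OF all_moments_mult[OF amR amQ]]])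
       (simp_all only: R Q restrict_apply' singletonI)
  finally show ?thesis by (simp add: mean)
qed

text \<open>
  A centred word that is independent of the others contributes the factor zero.
\<close>

lemma joint_moment_isolated:
  assumes "finite J" "j \<in> J"
    and "\<And>i. i \<in> J \<Longrightarrow> i \<noteq> j \<Longrightarrow> letters p (U i) \<inter> letters p (U j) = {}"
  shows "joint_moment p J U = 0"
proof -
  have "joint_moment p ({j} \<union> (J - {j})) U = joint_moment p {j} U * joint_moment p (J - {j}) U"
    using assms by (intro joint_moment_split) auto
  moreover have "{j} \<union> (J - {j}) = J" using assms by auto
  moreover have "joint_moment p {j} U = 0" by (simp add: joint_moment_def)
  ultimately show ?thesis by simp
qed

lemma joint_moment_nonessential:
  assumes "finite J" "\<not> essential p J U"
  shows "joint_moment p J U = 0"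
proof -
  from assms(2) consider
    (unique) j s where "j \<in> J" "s < p" "\<And>j' s'. j' \<in> J \<Longrightarrow> s' < p \<Longrightarrow> U j' s' = U j s \<Longrightarrow> (j', s') = (j, s)"
  | (isolated) j where "j \<in> J" "\<And>i. i \<in> J \<Longrightarrow> i \<noteq> j \<Longrightarrow> letters p (U i) \<inter> letters p (U j) = {}"
    unfolding essential_def by blast
  then show ?thesis
  proof cases
    case unique
    then show ?thesis using assms(1) by (intro joint_moment_unique_letter)
  next
    case isolated
    then show ?thesis using assms(1) by (intro joint_moment_isolated)
  qed
qed

text \<open>
  If the family is not essential, both sides vanish: a nonzero summand would split it into two essential
  families. If it is essential and not branching, then \<open>j0\<close> meets exactly one other word \<open>a\<close>, and
  \<open>a\<close> meets no further word; the joint moment factors accordingly, and the summands for all other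
  \<open>a\<close> vanish because they contain a pair of independent centred words.
\<close>

lemma joint_moment_wick:
  assumes J: "finite J" "j0 \<in> J" and good: "\<not> (essential p J U \<and> branching p J U)"
  shows "joint_moment p J U = (\<Sum>a\<in>J - {j0}. joint_moment p {j0, a} U * joint_moment p (J - {j0, a}) U)"
proof (cases "essential p J U")
  case False
  have "joint_moment p {j0, a} U * joint_moment p (J - {j0, a}) U = 0" if a: "a \<in> J - {j0}" for a
  proof (rule ccontr)
    assume "\<not> ?thesis"
    then have e: "essential p {j0, a} U" "essential p (J - {j0, a}) U"
      using joint_moment_nonessential[of "{j0, a}" p U] joint_moment_nonessential[of "J - {j0, a}" p U] J
      by auto
    have "essential p J U"
      unfolding essential_def
    proof (intro conjI ballI)
      fix j assume j: "j \<in> J"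
      obtain I where I: "j \<in> I" "I \<subseteq> J" "essential p I U"
      proof (cases "j \<in> {j0, a}")
        case True
        then show ?thesis using that[of "{j0, a}"] e(1) J a by auto
      next
        case False
        then show ?thesis using that[of "J - {j0, a}"] e(2) j by auto
      qed
      then show "\<forall>s<p. \<exists>j'\<in>J. \<exists>s'<p. (j', s') \<noteq> (j, s) \<and> U j' s' = U j s"
        "\<exists>j'\<in>J. j' \<noteq> j \<and> letters p (U j') \<inter> letters p (U j) \<noteq> {}"
        unfolding essential_def by (meson subsetD)+
    qed
    then show False using False by simp
  qed
  then have "(\<Sum>a\<in>J - {j0}. joint_moment p {j0, a} U * joint_moment p (J - {j0, a}) U) = 0"
    by (intro sum.neutral ballI)
  then show ?thesis using joint_moment_nonessential[OF J(1) False] by simp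
next
  case True
  then have nb: "\<not> branching p J U" using good by simp
  obtain a where a: "a \<in> J" "a \<noteq> j0" "letters p (U a) \<inter> letters p (U j0) \<noteq> {}"
    using True J unfolding essential_def by blast
  have only: "letters p (U l) \<inter> letters p (U j) = {}"
    if "j \<in> J" "i \<in> J" "l \<in> J" "i \<noteq> j" "l \<noteq> j" "i \<noteq> l" "letters p (U i) \<inter> letters p (U j) \<noteq> {}" for i j l
    using nb that unfolding branching_def by metis
  have other: "letters p (U b) \<inter> letters p (U j0) = {}" if "b \<in> J" "b \<noteq> j0" "b \<noteq> a" for b
    using only[of j0 a b] a that J by simp
  have other': "letters p (U b) \<inter> letters p (U a) = {}" if "b \<in> J" "b \<noteq> j0" "b \<noteq> a" for b
    using only[of a j0 b] a that J by (simp add: Int_commute)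
  have zero: "joint_moment p {j0, b} U * joint_moment p (J - {j0, b}) U = 0" if "b \<in> J - {j0} - {a}" for b
  proof -
    have "joint_moment p {j0, b} U = 0"
      using other[of b] that by (intro joint_moment_isolated[of _ j0]) auto
    then show ?thesis by simp
  qed
  have "joint_moment p ({j0, a} \<union> (J - {j0, a})) U = joint_moment p {j0, a} U * joint_moment p (J - {j0, a}) U"
    using J other other' by (intro joint_moment_split) (auto simp: Int_commute)
  moreover have "{j0, a} \<union> (J - {j0, a}) = J" using J a by auto
  moreover have "(\<Sum>b\<in>J - {j0}. joint_moment p {j0, b} U * joint_moment p (J - {j0, b}) U)
      = joint_moment p {j0, a} U * joint_moment p (J - {j0, a}) U
        + (\<Sum>b\<in>J - {j0} - {a}. joint_moment p {j0, b} U * joint_moment p (J - {j0, b}) U)"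
    using a J by (intro sum.remove) auto
  moreover have "(\<Sum>b\<in>J - {j0} - {a}. joint_moment p {j0, b} U * joint_moment p (J - {j0, b}) U) = 0"
    using zero by (intro sum.neutral ballI)
  ultimately show ?thesis by simp
qed

end

section \<open>A Wick recurrence for the moments of the fluctuation\<close>

text \<open>
  Families indexed by a disjoint union are pairs of families.
\<close>

lemma sum_PiE_union:
  fixes f g :: "('j \<Rightarrow> 'c) \<Rightarrow> real"
  assumes "I \<inter> J = {}"
    and f: "\<And>C. f (restrict C I) = f C" and g: "\<And>C. g (restrict C J) = g C"
  shows "(\<Sum>C\<in>PiE (I \<union> J) (\<lambda>_. A). f C * g C) = (\<Sum>C\<in>PiE I (\<lambda>_. A). f C) * (\<Sum>C\<in>PiE J (\<lambda>_. A). g C)"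
proof -
  have "(\<Sum>C\<in>PiE I (\<lambda>_. A). f C) * (\<Sum>C\<in>PiE J (\<lambda>_. A). g C)
      = (\<Sum>(C, D)\<in>PiE I (\<lambda>_. A) \<times> PiE J (\<lambda>_. A). f C * g D)"
    by (simp add: sum_product sum.cartesian_product)
  also have "\<dots> = (\<Sum>C\<in>PiE (I \<union> J) (\<lambda>_. A). f C * g C)"
  proof (rule sum.reindex_bij_witness[where i = "\<lambda>E. (restrict E I, restrict E J)"
        and j = "\<lambda>(C, D). \<lambda>k. if k \<in> I then C k else D k"])
    fix E assume "E \<in> PiE (I \<union> J) (\<lambda>_. A)"
    then show "(case (restrict E I, restrict E J) of (C, D) \<Rightarrow> \<lambda>k. if k \<in> I then C k else D k) = E"
      by (auto simp: fun_eq_iff PiE_iff extensional_def)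
  next
    fix CD assume CD: "CD \<in> PiE I (\<lambda>_. A) \<times> PiE J (\<lambda>_. A)"
    obtain C D where eq: "CD = (C, D)" by (cases CD)
    let ?E = "\<lambda>k. if k \<in> I then C k else D k"
    have 1: "restrict ?E I = C" "restrict ?E J = D"
      using CD assms(1) by (auto simp: eq fun_eq_iff PiE_iff extensional_def restrict_def)
    then show "(restrict (case CD of (C, D) \<Rightarrow> \<lambda>k. if k \<in> I then C k else D k) I,
          restrict (case CD of (C, D) \<Rightarrow> \<lambda>k. if k \<in> I then C k else D k) J) = CD"
      by (simp add: eq)
    have "f ?E * g ?E = f C * g D" using f[of ?E] g[of ?E] 1 by simp
    then show "f (case CD of (C, D) \<Rightarrow> \<lambda>k. if k \<in> I then C k else D k) *
          g (case CD of (C, D) \<Rightarrow> \<lambda>k. if k \<in> I then C k else D k) = (case CD of (C, D) \<Rightarrow> f C * g D)"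
      by (simp add: eq)
    show "(case CD of (C, D) \<Rightarrow> \<lambda>k. if k \<in> I then C k else D k) \<in> PiE (I \<union> J) (\<lambda>_. A)"
      using CD by (auto simp: eq PiE_iff extensional_def)
  next
    fix E assume "E \<in> PiE (I \<union> J) (\<lambda>_. A)"
    then show "(restrict E I, restrict E J) \<in> PiE I (\<lambda>_. A) \<times> PiE J (\<lambda>_. A)"
      by (auto simp: PiE_iff)
  qed
  finally show ?thesis by simp
qed

context independent_field begin

text \<open>
  The centred sum over circuits; the weight \<open>a\<close> is going to be the indicator that the circuit stays
  inside the support of the matrix.
\<close>

definition fluctuation ::
    "nat \<Rightarrow> nat \<Rightarrow> (nat \<Rightarrow> nat \<Rightarrow> 'i) \<Rightarrow> ((nat \<Rightarrow> nat) \<Rightarrow> real) \<Rightarrow> 'w \<Rightarrow> real" where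
  "fluctuation p N L a \<omega> = (\<Sum>c\<in>circuits p N. a c * centred_word p (word p L c) \<omega>)"

lemma all_moments_fluctuation: "all_moments (fluctuation p N L a)"
  unfolding fluctuation_def
  by (intro all_moments_sum all_moments_mult all_moments_const all_moments_centred_word)

definition weighted_moment ::
    "nat \<Rightarrow> (nat \<Rightarrow> nat \<Rightarrow> 'i) \<Rightarrow> ((nat \<Rightarrow> nat) \<Rightarrow> real) \<Rightarrow> nat set \<Rightarrow> (nat \<Rightarrow> nat \<Rightarrow> nat) \<Rightarrow> real" where
  "weighted_moment p L a J C = (\<Prod>j\<in>J. a (C j)) * joint_moment p J (\<lambda>j. word p L (C j))"

lemma weighted_moment_restrict: "weighted_moment p L a J (restrict C J) = weighted_moment p L a J C"
  by (simp add: weighted_moment_def joint_moment_def cong: prod.cong)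

lemma expectation_fluctuation_power:
  assumes "finite J"
  shows "expectation (\<lambda>\<omega>. fluctuation p N L a \<omega> ^ card J)
       = (\<Sum>C\<in>PiE J (\<lambda>_. circuits p N). weighted_moment p L a J C)"
proof -
  have "fluctuation p N L a \<omega> ^ card J
      = (\<Sum>C\<in>PiE J (\<lambda>_. circuits p N). (\<Prod>j\<in>J. a (C j)) * (\<Prod>j\<in>J. centred_word p (word p L (C j)) \<omega>))" for \<omega>
  proof -
    have "fluctuation p N L a \<omega> ^ card J = (\<Prod>j\<in>J. \<Sum>c\<in>circuits p N. a c * centred_word p (word p L c) \<omega>)"
      by (simp add: fluctuation_def)
    also have "\<dots> = (\<Sum>C\<in>PiE J (\<lambda>_. circuits p N). \<Prod>j\<in>J. a (C j) * centred_word p (word p L (C j)) \<omega>)"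
      using assms by (intro prod_sum_PiE) auto
    finally show ?thesis by (simp add: prod.distrib)
  qed
  moreover have "integrable M (\<lambda>\<omega>. (\<Prod>j\<in>J. a (C j)) * (\<Prod>j\<in>J. centred_word p (word p L (C j)) \<omega>))" for C
    by (intro all_moments_integrable all_moments_mult all_moments_const all_moments_prod all_moments_centred_word)
  ultimately show ?thesis
    by (simp add: weighted_moment_def joint_moment_def Bochner_Integration.integral_sum)
qed

text \<open>
  Both \<open>E (S^k)\<close> and each of the \<open>k - 1\<close> copies of \<open>E (S^2) * E (S^(k - 2))\<close> are sums over families of
  \<open>k\<close> circuits. The copies are labelled by the partner \<open>i\<close> of the word \<open>0\<close>, and the terms cancel for
  every family that is not both essential and branching.
\<close>

lemma fluctuation_moment_recurrence:
  assumes p: "0 < p" and k: "2 \<le> k"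
  shows "\<exists>K::real. 0 \<le> K \<and> (\<forall>N L a. (\<forall>c. \<bar>a c\<bar> \<le> 1) \<longrightarrow>
    \<bar>expectation (\<lambda>\<omega>. fluctuation p N L a \<omega> ^ k)
       - real (k - 1) * expectation (\<lambda>\<omega>. fluctuation p N L a \<omega> ^ 2)
           * expectation (\<lambda>\<omega>. fluctuation p N L a \<omega> ^ (k - 2))\<bar>
    \<le> K * card {C \<in> PiE {..<k} (\<lambda>_. circuits p N).
         essential p {..<k} (\<lambda>j. word p L (C j)) \<and> branching p {..<k} (\<lambda>j. word p L (C j))})"
proof -
  obtain K1 where K1: "0 \<le> K1" "\<And>J U. finite J \<Longrightarrow> card J = k \<Longrightarrow> \<bar>joint_moment p J U\<bar> \<le> K1"
    using joint_moment_bounded[OF p, of k] by blast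
  obtain K2 where K2: "0 \<le> K2" "\<And>J U. finite J \<Longrightarrow> card J = 2 \<Longrightarrow> \<bar>joint_moment p J U\<bar> \<le> K2"
    using joint_moment_bounded[OF p, of 2] by blast
  obtain K3 where K3: "0 \<le> K3" "\<And>J U. finite J \<Longrightarrow> card J = k - 2 \<Longrightarrow> \<bar>joint_moment p J U\<bar> \<le> K3"
    using joint_moment_bounded[OF p, of "k - 2"] by blast
  define K where "K = K1 + real (k - 1) * (K2 * K3)"
  let ?J = "{..<k}"
  show ?thesis
  proof (intro exI[of _ K] conjI allI impI)
    show "0 \<le> K" using K1 K2 K3 by (simp add: K_def)
    fix N and L :: "nat \<Rightarrow> nat \<Rightarrow> 'i" and a :: "(nat \<Rightarrow> nat) \<Rightarrow> real" assume "\<forall>c. \<bar>a c\<bar> \<le> 1"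
    then have a: "\<bar>a c\<bar> \<le> 1" for c by simp
    define F where "F = PiE ?J (\<lambda>_. circuits p N)"
    define Bad where "Bad = {C \<in> F. essential p ?J (\<lambda>j. word p L (C j)) \<and> branching p ?J (\<lambda>j. word p L (C j))}"
    define w where "w J C = (\<Prod>j\<in>J. a (C j))" for J :: "nat set" and C :: "nat \<Rightarrow> nat \<Rightarrow> nat"
    define m where "m J C = joint_moment p J (\<lambda>j. word p L (C j))" for J and C :: "nat \<Rightarrow> nat \<Rightarrow> nat"
    define E where "E i = expectation (\<lambda>\<omega>. fluctuation p N L a \<omega> ^ i)" for i
    have finF: "finite F" by (simp add: F_def finite_PiE)
    have J0: "0 \<in> ?J" using k by simp
    have cards: "card {0, i} = 2" "card (?J - {0, i}) = k - 2" "{0, i} \<union> (?J - {0, i}) = ?J" if "i \<in> ?J - {0}" for i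
      using that k by (auto simp: card_Diff_subset)
    have "E 2 * E (k - 2) = (\<Sum>C\<in>F. w ?J C * (m {0, i} C * m (?J - {0, i}) C))" if i: "i \<in> ?J - {0}" for i
    proof -
      have "E 2 * E (k - 2) = E (card {0, i}) * E (card (?J - {0, i}))" using cards[OF i] by simp
      also have "\<dots> = (\<Sum>C\<in>PiE {0, i} (\<lambda>_. circuits p N). weighted_moment p L a {0, i} C) *
          (\<Sum>C\<in>PiE (?J - {0, i}) (\<lambda>_. circuits p N). weighted_moment p L a (?J - {0, i}) C)"
        unfolding E_def by (subst (1 2) expectation_fluctuation_power) auto
      also have "\<dots> = (\<Sum>C\<in>PiE ({0, i} \<union> (?J - {0, i})) (\<lambda>_. circuits p N).
          weighted_moment p L a {0, i} C * weighted_moment p L a (?J - {0, i}) C)"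
        by (intro sum_PiE_union[symmetric] weighted_moment_restrict) auto
      also have "\<dots> = (\<Sum>C\<in>F. w ?J C * (m {0, i} C * m (?J - {0, i}) C))"
        unfolding cards(3)[OF i] F_def[symmetric]
      proof (rule sum.cong[OF refl])
        fix C
        have "w ?J C = w {0, i} C * w (?J - {0, i}) C"
          unfolding w_def by (subst cards(3)[OF i, symmetric], rule prod.union_disjoint) auto
        then show "weighted_moment p L a {0, i} C * weighted_moment p L a (?J - {0, i}) C =
            w ?J C * (m {0, i} C * m (?J - {0, i}) C)"
          by (simp add: weighted_moment_def w_def m_def)
      qed
      finally show ?thesis .
    qed
    then have "(\<Sum>i\<in>?J - {0}. E 2 * E (k - 2)) = (\<Sum>i\<in>?J - {0}. \<Sum>C\<in>F. w ?J C * (m {0, i} C * m (?J - {0, i}) C))"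
      by (intro sum.cong) auto
    moreover have "(\<Sum>i\<in>?J - {0}. E 2 * E (k - 2)) = real (k - 1) * E 2 * E (k - 2)"
      using J0 by (simp add: card_Diff_subset)
    ultimately have E2: "real (k - 1) * E 2 * E (k - 2) = (\<Sum>C\<in>F. w ?J C * (\<Sum>i\<in>?J - {0}. m {0, i} C * m (?J - {0, i}) C))"
      by (simp add: sum.swap[of _ F] sum_distrib_left)
    have "E k = (\<Sum>C\<in>F. w ?J C * m ?J C)"
      using expectation_fluctuation_power[of ?J p N L a] by (simp add: E_def F_def w_def m_def weighted_moment_def)
    with E2 have "E k - real (k - 1) * E 2 * E (k - 2)
        = (\<Sum>C\<in>F. w ?J C * (m ?J C - (\<Sum>i\<in>?J - {0}. m {0, i} C * m (?J - {0, i}) C)))"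
      by (simp add: sum_subtractf right_diff_distrib)
    also have "\<dots> = (\<Sum>C\<in>Bad. w ?J C * (m ?J C - (\<Sum>i\<in>?J - {0}. m {0, i} C * m (?J - {0, i}) C)))"
    proof (rule sum.mono_neutral_right[OF finF])
      show "\<forall>C\<in>F - Bad. w ?J C * (m ?J C - (\<Sum>i\<in>?J - {0}. m {0, i} C * m (?J - {0, i}) C)) = 0"
      proof
        fix C assume "C \<in> F - Bad"
        then have "m ?J C = (\<Sum>i\<in>?J - {0}. m {0, i} C * m (?J - {0, i}) C)"
          unfolding m_def using J0 by (intro joint_moment_wick) (auto simp: Bad_def)
        then show "w ?J C * (m ?J C - (\<Sum>i\<in>?J - {0}. m {0, i} C * m (?J - {0, i}) C)) = 0" by simp
      qed
    qed (auto simp: Bad_def)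
    finally have "\<bar>E k - real (k - 1) * E 2 * E (k - 2)\<bar>
        \<le> (\<Sum>C\<in>Bad. \<bar>w ?J C * (m ?J C - (\<Sum>i\<in>?J - {0}. m {0, i} C * m (?J - {0, i}) C))\<bar>)"
      by (simp only: sum_abs)
    also have "\<dots> \<le> real (card Bad) * K"
    proof (rule sum_bounded_above)
      fix C
      have "\<bar>w ?J C\<bar> \<le> 1" unfolding w_def abs_prod using a by (intro prod_le_1) auto
      moreover have "\<bar>m ?J C - (\<Sum>i\<in>?J - {0}. m {0, i} C * m (?J - {0, i}) C)\<bar> \<le> K"
      proof -
        have "\<bar>\<Sum>i\<in>?J - {0}. m {0, i} C * m (?J - {0, i}) C\<bar> \<le> (\<Sum>i\<in>?J - {0}. \<bar>m {0, i} C * m (?J - {0, i}) C\<bar>)"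
          by (rule sum_abs)
        also have "\<dots> \<le> real (card (?J - {0})) * (K2 * K3)"
        proof (rule sum_bounded_above)
          fix i assume "i \<in> ?J - {0}"
          then show "\<bar>m {0, i} C * m (?J - {0, i}) C\<bar> \<le> K2 * K3"
            unfolding abs_mult m_def using K2 K3 cards by (intro mult_mono) auto
        qed
        also have "real (card (?J - {0})) = real (k - 1)" using J0 by (simp add: card_Diff_subset)
        finally have "\<bar>\<Sum>i\<in>?J - {0}. m {0, i} C * m (?J - {0, i}) C\<bar> \<le> real (k - 1) * (K2 * K3)" .
        moreover have "\<bar>m ?J C\<bar> \<le> K1" unfolding m_def by (intro K1(2)) auto
        ultimately show ?thesis
          unfolding K_def using abs_triangle_ineq4[of "m ?J C" "\<Sum>i\<in>?J - {0}. m {0, i} C * m (?J - {0, i}) C"]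
          by linarith
      qed
      ultimately show "\<bar>w ?J C * (m ?J C - (\<Sum>i\<in>?J - {0}. m {0, i} C * m (?J - {0, i}) C))\<bar> \<le> K"
        unfolding abs_mult using mult_mono[of "\<bar>w ?J C\<bar>" 1 _ K] by simp
    qed
    finally show "\<bar>expectation (\<lambda>\<omega>. fluctuation p N L a \<omega> ^ k)
       - real (k - 1) * expectation (\<lambda>\<omega>. fluctuation p N L a \<omega> ^ 2)
           * expectation (\<lambda>\<omega>. fluctuation p N L a \<omega> ^ (k - 2))\<bar>
      \<le> K * card {C \<in> PiE ?J (\<lambda>_. circuits p N).
         essential p ?J (\<lambda>j. word p L (C j)) \<and> branching p ?J (\<lambda>j. word p L (C j))}"
      by (simp add: E_def Bad_def F_def mult.commute)
  qed
qed

lemma fluctuation_moment_recurrence_bound: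
  assumes p: "0 < p" "even p" and k: "2 \<le> k" and B: "1 \<le> B"
  shows "\<exists>K::real. 0 \<le> K \<and> (\<forall>N L a. 1 \<le> N \<longrightarrow> (\<forall>c. \<bar>a c\<bar> \<le> 1) \<longrightarrow>
      (\<forall>i<N. \<forall>t. card {l. l < N \<and> L i l = t} \<le> B) \<longrightarrow>
      \<bar>expectation (\<lambda>\<omega>. fluctuation p N L a \<omega> ^ k)
         - real (k - 1) * expectation (\<lambda>\<omega>. fluctuation p N L a \<omega> ^ 2)
             * expectation (\<lambda>\<omega>. fluctuation p N L a \<omega> ^ (k - 2))\<bar>
      \<le> K * sqrt (real N ^ (k * (p + 1) - 1)))"
proof -
  obtain K :: real where K: "0 \<le> K" and rec: "\<forall>N L a. (\<forall>c. \<bar>a c\<bar> \<le> 1) \<longrightarrow>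
    \<bar>expectation (\<lambda>\<omega>. fluctuation p N L a \<omega> ^ k)
       - real (k - 1) * expectation (\<lambda>\<omega>. fluctuation p N L a \<omega> ^ 2)
           * expectation (\<lambda>\<omega>. fluctuation p N L a \<omega> ^ (k - 2))\<bar>
    \<le> K * card {C \<in> PiE {..<k} (\<lambda>_. circuits p N).
         essential p {..<k} (\<lambda>j. word p L (C j)) \<and> branching p {..<k} (\<lambda>j. word p L (C j))}"
    using fluctuation_moment_recurrence[OF p(1) k] by (elim exE conjE)
  show ?thesis
  proof (intro exI[of _ "K * real ((k * p) ^ (k * p) * B ^ (p * k))"] conjI allI impI)
    show "0 \<le> K * real ((k * p) ^ (k * p) * B ^ (p * k))" using K by simp
    fix N and L :: "nat \<Rightarrow> nat \<Rightarrow> 'i" and a :: "(nat \<Rightarrow> nat) \<Rightarrow> real"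
    assume N: "1 \<le> N" and a: "\<forall>c. \<bar>a c\<bar> \<le> 1"
      and "\<forall>i<N. \<forall>t. card {l. l < N \<and> L i l = t} \<le> B"
    then have bound: "\<And>i t. i < N \<Longrightarrow> card {l. l < N \<and> L i l = t} \<le> B" by simp
    show "\<bar>expectation (\<lambda>\<omega>. fluctuation p N L a \<omega> ^ k)
         - real (k - 1) * expectation (\<lambda>\<omega>. fluctuation p N L a \<omega> ^ 2)
             * expectation (\<lambda>\<omega>. fluctuation p N L a \<omega> ^ (k - 2))\<bar>
      \<le> K * real ((k * p) ^ (k * p) * B ^ (p * k)) * sqrt (real N ^ (k * (p + 1) - 1))"
      using order_trans[OF rec[THEN spec[of _ N], THEN spec[of _ L], THEN spec[of _ a], THEN mp, OF a]
          mult_left_mono[OF card_branching_families_le[OF p N B bound, where k = k] K]]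
      by (simp only: mult.assoc)
  qed
qed

end

section \<open>Traces of powers as sums over circuits\<close>

text \<open>
  Walks from \<open>i\<close> to \<open>j\<close> in \<open>m\<close> steps, both ends included; circuits drop the repeated end vertex.
\<close>

definition walks :: "nat \<Rightarrow> nat \<Rightarrow> nat \<Rightarrow> nat \<Rightarrow> (nat \<Rightarrow> nat) set" where
  "walks m N i j = {c \<in> PiE {..m} (\<lambda>_. {..<N}). c 0 = i \<and> c m = j}"

lemma finite_walks [simp]: "finite (walks m N i j)"
  unfolding walks_def by (rule finite_subset[OF _ finite_PiE[of "{..m}" "\<lambda>_. {..<N}"]]) auto

lemma pow_mat_eq_sum_walks:
  fixes A :: "real mat"
  assumes A: "A \<in> carrier_mat N N" and "i < N" "j < N"
  shows "(A ^\<^sub>m m) $$ (i, j) = (\<Sum>c\<in>walks m N i j. \<Prod>s<m. A $$ (c s, c (Suc s)))"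
  using \<open>j < N\<close>
proof (induction m arbitrary: j)
  case 0
  have "walks 0 N i j = (if i = j then {restrict (\<lambda>_. i) {..0}} else {})"
    using \<open>i < N\<close> by (auto simp: walks_def PiE_iff extensional_def fun_eq_iff)
  then show ?case using A assms 0 by simp
next
  case (Suc m)
  have car: "A ^\<^sub>m m \<in> carrier_mat N N" using A by (rule pow_carrier_mat)
  have "(A ^\<^sub>m Suc m) $$ (i, j) = (\<Sum>l<N. (A ^\<^sub>m m) $$ (i, l) * A $$ (l, j))"
    using A car \<open>i < N\<close> Suc.prems by (simp add: scalar_prod_def lessThan_atLeast0)
  also have "\<dots> = (\<Sum>l<N. \<Sum>c\<in>walks m N i l. (\<Prod>s<m. A $$ (c s, c (Suc s))) * A $$ (l, j))"
    using Suc.IH by (intro sum.cong) (auto simp: sum_distrib_right)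
  also have "\<dots> = (\<Sum>(l, c)\<in>Sigma {..<N} (walks m N i). (\<Prod>s<m. A $$ (c s, c (Suc s))) * A $$ (l, j))"
    by (intro sum.Sigma) auto
  also have "\<dots> = (\<Sum>c\<in>walks (Suc m) N i j. \<Prod>s<Suc m. A $$ (c s, c (Suc s)))"
  proof (rule sum.reindex_bij_witness[where j = "\<lambda>(l, c). c(Suc m := j)" and i = "\<lambda>c. (c m, restrict c {..m})"])
    fix c assume c: "c \<in> walks (Suc m) N i j"
    then show "(case (c m, restrict c {..m}) of (l, c) \<Rightarrow> c(Suc m := j)) = c"
      by (auto simp: walks_def PiE_iff extensional_def fun_eq_iff)
    show "(c m, restrict c {..m}) \<in> Sigma {..<N} (walks m N i)"
      using c by (auto simp: walks_def PiE_iff)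
  next
    fix lc assume lc: "lc \<in> Sigma {..<N} (walks m N i)"
    obtain l c where eq: "lc = (l, c)" by (cases lc)
    have c: "c \<in> walks m N i l" "l < N" using lc by (auto simp: eq)
    show "((case lc of (l, c) \<Rightarrow> c(Suc m := j)) m, restrict (case lc of (l, c) \<Rightarrow> c(Suc m := j)) {..m}) = lc"
      using c by (auto simp: eq walks_def PiE_iff extensional_def fun_eq_iff)
    show "(case lc of (l, c) \<Rightarrow> c(Suc m := j)) \<in> walks (Suc m) N i j"
      using c Suc.prems by (auto simp: eq walks_def PiE_iff extensional_def)
    have "(\<Prod>s<m. A $$ ((c(Suc m := j)) s, (c(Suc m := j)) (Suc s))) = (\<Prod>s<m. A $$ (c s, c (Suc s)))"
      by (intro prod.cong) auto
    then show "(\<Prod>s<Suc m. A $$ ((case lc of (l, c) \<Rightarrow> c(Suc m := j)) s, (case lc of (l, c) \<Rightarrow> c(Suc m := j)) (Suc s)))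
        = (case lc of (l, c) \<Rightarrow> (\<Prod>s<m. A $$ (c s, c (Suc s))) * A $$ (l, j))"
      using c by (simp add: eq walks_def)
  qed
  finally show ?case .
qed

lemma mat_trace_pow_eq_sum_circuits:
  fixes A :: "real mat"
  assumes A: "A \<in> carrier_mat N N" and p: "0 < p"
  shows "mat_trace (A ^\<^sub>m p) = (\<Sum>c\<in>circuits p N. \<Prod>s<p. A $$ (c s, c (Suc s mod p)))"
proof -
  have "A ^\<^sub>m p \<in> carrier_mat N N" using A by (rule pow_carrier_mat)
  then have "mat_trace (A ^\<^sub>m p) = (\<Sum>i<N. (A ^\<^sub>m p) $$ (i, i))"
    using A by (simp add: mat_trace_def)
  also have "\<dots> = (\<Sum>i<N. \<Sum>c\<in>walks p N i i. \<Prod>s<p. A $$ (c s, c (Suc s)))"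
    using pow_mat_eq_sum_walks[OF A] by (intro sum.cong) auto
  also have "\<dots> = (\<Sum>(i, c)\<in>Sigma {..<N} (\<lambda>i. walks p N i i). \<Prod>s<p. A $$ (c s, c (Suc s)))"
    by (intro sum.Sigma) auto
  also have "\<dots> = (\<Sum>c\<in>circuits p N. \<Prod>s<p. A $$ (c s, c (Suc s mod p)))"
  proof (rule sum.reindex_bij_witness[where j = "\<lambda>(i, c). restrict c {..<p}" and i = "\<lambda>c. (c 0, c(p := c 0))"])
    fix c assume c: "c \<in> circuits p N"
    then show "(case (c 0, c(p := c 0)) of (i, c) \<Rightarrow> restrict c {..<p}) = c"
      by (auto simp: circuits_def PiE_iff extensional_def fun_eq_iff)
    show "(c 0, c(p := c 0)) \<in> Sigma {..<N} (\<lambda>i. walks p N i i)"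
      using c p by (auto simp: circuits_def walks_def PiE_iff extensional_def)
  next
    fix ic assume ic: "ic \<in> Sigma {..<N} (\<lambda>i. walks p N i i)"
    obtain i c where eq: "ic = (i, c)" by (cases ic)
    have c: "c \<in> walks p N i i" "i < N" using ic by (auto simp: eq)
    show "((case ic of (i, c) \<Rightarrow> restrict c {..<p}) 0,
        (case ic of (i, c) \<Rightarrow> restrict c {..<p})(p := (case ic of (i, c) \<Rightarrow> restrict c {..<p}) 0)) = ic"
      using c p by (auto simp: eq walks_def PiE_iff extensional_def fun_eq_iff)
    show "(case ic of (i, c) \<Rightarrow> restrict c {..<p}) \<in> circuits p N"
      using c by (auto simp: eq walks_def circuits_def PiE_iff)
    have "A $$ (restrict c {..<p} s, restrict c {..<p} (Suc s mod p)) = A $$ (c s, c (Suc s))" if "s < p" for s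
      using c that p by (cases "Suc s = p") (auto simp: walks_def)
    then show "(\<Prod>s<p. A $$ ((case ic of (i, c) \<Rightarrow> restrict c {..<p}) s, (case ic of (i, c) \<Rightarrow> restrict c {..<p}) (Suc s mod p)))
        = (case ic of (i, c) \<Rightarrow> \<Prod>s<p. A $$ (c s, c (Suc s)))"
      by (simp add: eq)
  qed
  finally show ?thesis .
qed

text \<open>
  The link function on matrix indices, which start from 0.
\<close>

definition shift_link :: "(nat \<Rightarrow> nat \<Rightarrow> 'i) \<Rightarrow> nat \<Rightarrow> nat \<Rightarrow> 'i" where
  "shift_link L i j = L (Suc i) (Suc j)"

definition support_weight :: "nat \<Rightarrow> (nat \<times> nat) set \<Rightarrow> (nat \<Rightarrow> nat) \<Rightarrow> real" where
  "support_weight p D c = (\<Prod>s<p. of_bool ((Suc (c s), Suc (c (Suc s mod p))) \<in> D))"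

lemma abs_support_weight_le: "\<bar>support_weight p D c\<bar> \<le> 1"
  unfolding support_weight_def abs_prod by (intro prod_le_1) auto

lemma card_shift_link_le:
  assumes "real (card {l \<in> {1..N}. L (Suc i) l = t}) \<le> B"
  shows "card {l. l < N \<and> shift_link L i l = t} \<le> max 1 (nat \<lceil>B\<rceil>)"
proof -
  have "card {l. l < N \<and> shift_link L i l = t} \<le> card {l \<in> {1..N}. L (Suc i) l = t}"
    by (rule card_inj_on_le[of Suc]) (auto simp: shift_link_def)
  moreover have "card {l \<in> {1..N}. L (Suc i) l = t} \<le> nat \<lceil>B\<rceil>"
    using assms by linarith
  ultimately show ?thesis by linarith
qed

lemma trace_power_eq_sum_circuits:
  assumes p: "0 < p"
  shows "trace_power p N L D x \<omega> = (1 / sqrt (real N)) ^ p *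
    (\<Sum>c\<in>circuits p N. support_weight p D c * (\<Prod>s<p. x (word p (shift_link L) c s) \<omega>))"
proof -
  let ?A = "(1 / sqrt (real N)) \<cdot>\<^sub>m link_matrix N L D (\<lambda>t. x t \<omega>)"
  have "?A \<in> carrier_mat N N" by (simp add: link_matrix_def)
  then have "trace_power p N L D x \<omega> = (\<Sum>c\<in>circuits p N. \<Prod>s<p. ?A $$ (c s, c (Suc s mod p)))"
    unfolding trace_power_def using p by (rule mat_trace_pow_eq_sum_circuits)
  also have "\<dots> = (\<Sum>c\<in>circuits p N. \<Prod>s<p. 1 / sqrt (real N) *
      (of_bool ((Suc (c s), Suc (c (Suc s mod p))) \<in> D) * x (word p (shift_link L) c s) \<omega>))"
  proof (intro sum.cong prod.cong refl)
    fix c s assume "c \<in> circuits p N" "s \<in> {..<p}"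
    then have "c s < N" "c (Suc s mod p) < N" using p by (auto simp: circuits_def PiE_iff)
    then show "?A $$ (c s, c (Suc s mod p)) = 1 / sqrt (real N) *
      (of_bool ((Suc (c s), Suc (c (Suc s mod p))) \<in> D) * x (word p (shift_link L) c s) \<omega>)"
      by (simp add: link_matrix_def word_def shift_link_def)
  qed
  finally show ?thesis
    unfolding prod.distrib by (simp add: support_weight_def sum_distrib_left mult.assoc)
qed

section \<open>The central limit theorem\<close>

lemma (in prob_space) all_moments_standardized:
  assumes "all_moments X" shows "all_moments (standardized X)"
proof -
  have "all_moments (\<lambda>\<omega>. (X \<omega> - expectation X) * (1 / sqrt (variance X)))"
    using assms by (intro all_moments_mult all_moments_diff all_moments_const)
  moreover have "standardized X = (\<lambda>\<omega>. (X \<omega> - expectation X) * (1 / sqrt (variance X)))"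
    by (simp add: fun_eq_iff standardized_def)
  ultimately show ?thesis by simp
qed

text \<open>
  Standardisation is invariant under affine maps. So the scaling by \<open>sqrt N\<close> and the centring of the
  trace disappear from the normalised fluctuation.
\<close>

lemma (in prob_space) standardized_scaled:
  assumes r: "0 < r" and S: "all_moments S" "expectation S = 0" and X: "\<And>\<omega>. X \<omega> = r * S \<omega> + b"
  shows "variance X = r\<^sup>2 * expectation (\<lambda>\<omega>. S \<omega> ^ 2)"
    and "standardized X \<omega> = S \<omega> / sqrt (expectation (\<lambda>\<omega>. S \<omega> ^ 2))"
proof -
  have "expectation X = b"
    unfolding X using all_moments_integrable[OF S(1)] S(2) by (simp add: prob_space)
  then have centred: "X \<omega> - expectation X = r * S \<omega>" for \<omega> by (simp add: X)
  then show var: "variance X = r\<^sup>2 * expectation (\<lambda>\<omega>. S \<omega> ^ 2)"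
    by (simp add: power_mult_distrib)
  show "standardized X \<omega> = S \<omega> / sqrt (expectation (\<lambda>\<omega>. S \<omega> ^ 2))"
    unfolding standardized_def var unfolding centred using r by (simp add: real_sqrt_mult)
qed

lemma (in independent_field) trace_power_eq_fluctuation:
  assumes "0 < p"
  shows "trace_power p N L D x \<omega> = (1 / sqrt (real N)) ^ p * fluctuation p N (shift_link L) (support_weight p D) \<omega>
    + (1 / sqrt (real N)) ^ p * (\<Sum>c\<in>circuits p N. support_weight p D c * expectation (word_value p (word p (shift_link L) c)))"
  unfolding trace_power_eq_sum_circuits[OF assms] fluctuation_def centred_word_def
  by (simp add: word_value_def right_diff_distrib sum_subtractf)

lemma (in independent_field) all_moments_trace_power:
  "0 < p \<Longrightarrow> all_moments (trace_power p N L D x)"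
proof -
  assume "0 < p"
  then have "trace_power p N L D x = (\<lambda>\<omega>. (1 / sqrt (real N)) ^ p *
    (\<Sum>c\<in>circuits p N. support_weight p D c * (\<Prod>s<p. x (word p (shift_link L) c s) \<omega>)))"
    by (intro ext trace_power_eq_sum_circuits)
  then show ?thesis
    by (auto intro!: all_moments_mult all_moments_const all_moments_sum all_moments_prod all_moments_entry)
qed

lemma (in independent_field) expectation_fluctuation: "expectation (fluctuation p N L a) = 0"
  using expectation_fluctuation_power[of "{0}" p N L a] joint_moment_isolated[of "{0}" 0 p]
  by (simp add: weighted_moment_def)

text \<open>
  The passage to normalised moments: here \<open>E2\<close> is the variance of the fluctuation, \<open>E\<close> and \<open>E'\<close> are its
  moments of order \<open>k\<close> and \<open>k - 2\<close>, and \<open>q = p + 1\<close>. The exponent \<open>k * q - 1\<close> of the error is by one below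
  that of \<open>E2 ^ k\<close>, and this is what remains of \<open>N\<close>.
\<close>

lemma normalised_remainder_le:
  fixes c K b E E2 E' :: real
  assumes c: "0 < c" and N: "1 \<le> N" and K: "0 \<le> K" and k: "2 \<le> k" and q: "1 \<le> q"
    and low: "c * real N ^ q \<le> E2"
    and D: "\<bar>E - b * E2 * E'\<bar> \<le> K * sqrt (real N ^ (k * q - 1))"
  shows "\<bar>E / sqrt E2 ^ k - b * (E' / sqrt E2 ^ (k - 2))\<bar> \<le> K / sqrt (c ^ k * real N)"
proof -
  have N0: "0 < real N" using N by simp
  have E2: "0 < E2" using low c N0 by (meson less_le_trans mult_pos_pos zero_less_power)
  have "sqrt E2 ^ k = sqrt E2 ^ (k - 2) * (sqrt E2)\<^sup>2"
    using le_Suc_ex[OF k] by (auto simp: power_add power2_eq_square mult_ac)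
  then have split: "sqrt E2 ^ k = sqrt E2 ^ (k - 2) * E2" using E2 by simp
  have "E / sqrt E2 ^ k - b * (E' / sqrt E2 ^ (k - 2)) = (E - b * E2 * E') / sqrt E2 ^ k"
    unfolding split using E2 by (simp add: field_simps)
  then have "\<bar>E / sqrt E2 ^ k - b * (E' / sqrt E2 ^ (k - 2))\<bar> = \<bar>E - b * E2 * E'\<bar> / sqrt E2 ^ k"
    using E2 by (simp add: abs_divide)
  also have "\<dots> \<le> (K * sqrt (real N ^ (k * q - 1))) / (sqrt (c ^ k * real N) * sqrt (real N ^ (k * q - 1)))"
  proof (rule frac_le)
    have "1 \<le> k * q" using k q by (metis One_nat_def Suc_leD mult_le_mono nat_mult_1 numeral_2_eq_2)
    then have "(c * real N ^ q) ^ k = c ^ k * (real N * real N ^ (k * q - 1))"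
      by (simp add: power_mult_distrib mult.commute[of k] flip: power_mult power_Suc)
    then have "sqrt (c ^ k * real N) * sqrt (real N ^ (k * q - 1)) = sqrt (c * real N ^ q) ^ k"
      by (simp add: mult.assoc flip: real_sqrt_mult real_sqrt_power)
    also have "\<dots> \<le> sqrt E2 ^ k" using low c by (intro power_mono) auto
    finally show "sqrt (c ^ k * real N) * sqrt (real N ^ (k * q - 1)) \<le> sqrt E2 ^ k" .
  qed (use D K c N0 in auto)
  also have "\<dots> = K / sqrt (c ^ k * real N)" using N0 by simp
  finally show ?thesis .
qed

theorem theorem2:
  fixes M :: "'w measure"
    and N :: "nat \<Rightarrow> nat"
    and L :: "nat \<Rightarrow> nat \<Rightarrow> nat \<Rightarrow> int ^ 'd"
    and \<Delta> :: "nat \<Rightarrow> (nat \<times> nat) set"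
    and x :: "int ^ 'd \<Rightarrow> 'w \<Rightarrow> real"
    and p :: nat
  assumes prob: "prob_space M"
    and N_pos: "\<forall>n\<ge>1. N n \<ge> 1"
    and N_mono: "strict_mono_on {1..} N"
    and L_sym: "\<forall>n\<ge>1. \<forall>i\<in>{1..N n}. \<forall>j\<in>{1..N n}. L n i j = L n j i"
    and \<Delta>_subset: "\<forall>n\<ge>1. \<Delta> n \<subseteq> {1..N n} \<times> {1..N n}"
    and \<Delta>_sym: "\<forall>n\<ge>1. sym (\<Delta> n)"
    and p_even: "even p" and p_pos: "p > 0"
    and L_bound: "\<exists>B::real. \<forall>n\<ge>1. \<forall>t. \<forall>k\<in>{1..N n}. real (card {l \<in> {1..N n}. L n k l = t}) \<le> B"
    and x_indep: "prob_space.indep_vars M (\<lambda>_. borel) x UNIV"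
    and x_mean: "\<forall>i. prob_space.expectation M (x i) = 0"
    and x_moments: "\<forall>k::nat. (SUP i. \<integral>\<^sup>+ \<omega>. ennreal (\<bar>x i \<omega>\<bar> ^ k) \<partial>M) < \<infinity>"
    and var_lower: "\<exists>c>0. \<forall>n\<ge>1.
      c * real (N n) \<le> prob_space.variance M (trace_power p (N n) (L n) (\<Delta> n) x)"
  shows "weak_conv_m
    (\<lambda>n. distr M borel (prob_space.standardized M (trace_power p (N n) (L n) (\<Delta> n) x)))
    std_normal_distribution"
proof -
  interpret prob_space M by (rule prob)
  interpret independent_field M x
    using x_indep x_mean x_moments by unfold_locales auto
  obtain B :: real where B: "\<forall>n\<ge>1. \<forall>t. \<forall>k\<in>{1..N n}. real (card {l \<in> {1..N n}. L n k l = t}) \<le> B"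
    using L_bound by blast
  obtain c where c: "0 < c" "\<forall>n\<ge>1. c * real (N n) \<le> variance (trace_power p (N n) (L n) (\<Delta> n) x)"
    using var_lower by blast
  define T where "T n = trace_power p (N n) (L n) (\<Delta> n) x" for n
  define S where "S n = fluctuation p (N n) (shift_link (L n)) (support_weight p (\<Delta> n))" for n
  define m where "m k n = expectation (\<lambda>\<omega>. standardized (T n) \<omega> ^ k)" for k n
  have am: "all_moments (standardized (T n))" for n
    unfolding T_def by (intro all_moments_standardized all_moments_trace_power p_pos)
  have [measurable]: "standardized (T n) \<in> borel_measurable M" for n
    using am by (rule all_moments_measurable)
  have N_ge: "n \<le> N n" if "1 \<le> n" for n
    using that
  proof (induction n rule: dec_induct)
    case base
    then show ?case using N_pos by simp
  next
    case (step n)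
    then have "N n < N (Suc n)" using N_mono by (auto simp: strict_mono_on_def)
    then show ?case using step by simp
  qed
  have amS: "all_moments (S n)" for n unfolding S_def by (rule all_moments_fluctuation)
  have var: "variance (T n) = (1 / real (N n) ^ p) * expectation (\<lambda>\<omega>. S n \<omega> ^ 2)"
    and standardized: "standardized (T n) \<omega> = S n \<omega> / sqrt (expectation (\<lambda>\<omega>. S n \<omega> ^ 2))"
    if n: "1 \<le> n" for n \<omega>
  proof -
    have N: "0 < real (N n)" using N_pos n by fastforce
    then have r: "0 < (1 / sqrt (real (N n))) ^ p" by simp
    have r2: "((1 / sqrt (real (N n))) ^ p)\<^sup>2 = 1 / real (N n) ^ p"
      using N by (simp add: power_divide flip: power_mult) (simp add: power_mult mult.commute[of p])
    note * = standardized_scaled[OF r amS[of n] _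
        trace_power_eq_fluctuation[OF p_pos, of "N n" "L n" "\<Delta> n", folded S_def T_def]]
    show "variance (T n) = (1 / real (N n) ^ p) * expectation (\<lambda>\<omega>. S n \<omega> ^ 2)"
      "standardized (T n) \<omega> = S n \<omega> / sqrt (expectation (\<lambda>\<omega>. S n \<omega> ^ 2))"
      using * expectation_fluctuation unfolding r2 by (auto simp: S_def)
  qed
  have moment: "m k n = expectation (\<lambda>\<omega>. S n \<omega> ^ k) / sqrt (expectation (\<lambda>\<omega>. S n \<omega> ^ 2)) ^ k"
    if "1 \<le> n" for k n
    unfolding m_def standardized[OF that] by (simp add: power_divide)
  have "m k \<longlonglongrightarrow> (LINT x|std_normal_distribution. x ^ k)" for k
  proof (rule std_normal_moment_limit)
    show "m 0 \<longlonglongrightarrow> 1" by (simp add: m_def[abs_def] prob_space)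
    have "eventually (\<lambda>n. m 1 n = 0) sequentially"
      using eventually_ge_at_top[of 1]
    proof eventually_elim
      case (elim n)
      then show ?case
        using moment[OF elim, of 1] expectation_fluctuation by (simp add: S_def)
    qed
    then show "m 1 \<longlonglongrightarrow> 0" by (rule tendsto_eventually)
  next
    fix k :: nat assume k: "2 \<le> k"
    obtain K :: real where K: "0 \<le> K" and rec: "\<forall>N L a. 1 \<le> N \<longrightarrow> (\<forall>c. \<bar>a c\<bar> \<le> 1) \<longrightarrow>
      (\<forall>i<N. \<forall>t. card {l. l < N \<and> L i l = t} \<le> max 1 (nat \<lceil>B\<rceil>)) \<longrightarrow>
      \<bar>expectation (\<lambda>\<omega>. fluctuation p N L a \<omega> ^ k)
         - real (k - 1) * expectation (\<lambda>\<omega>. fluctuation p N L a \<omega> ^ 2)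
             * expectation (\<lambda>\<omega>. fluctuation p N L a \<omega> ^ (k - 2))\<bar>
      \<le> K * sqrt (real N ^ (k * (p + 1) - 1))"
      using fluctuation_moment_recurrence_bound[OF p_pos p_even k, of "max 1 (nat \<lceil>B\<rceil>)"] by auto
    have bound: "\<bar>m k n - real (k - 1) * m (k - 2) n\<bar> \<le> K / sqrt (c ^ k * real n)" if n: "1 \<le> n" for n
    proof -
      have N: "1 \<le> N n" using N_pos n by simp
      have "card {l. l < N n \<and> shift_link (L n) i l = t} \<le> max 1 (nat \<lceil>B\<rceil>)" if "i < N n" for i t
        using B n that by (intro card_shift_link_le) auto
      then have rem: "\<bar>expectation (\<lambda>\<omega>. S n \<omega> ^ k) - real (k - 1) * expectation (\<lambda>\<omega>. S n \<omega> ^ 2)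
            * expectation (\<lambda>\<omega>. S n \<omega> ^ (k - 2))\<bar> \<le> K * sqrt (real (N n) ^ (k * (p + 1) - 1))"
        unfolding S_def using N by (intro rec[rule_format] abs_support_weight_le) auto
      have "c * real (N n) \<le> variance (T n)"
        unfolding T_def using c(2) n by blast
      then have "c * real (N n) \<le> (1 / real (N n) ^ p) * expectation (\<lambda>\<omega>. S n \<omega> ^ 2)"
        unfolding var[OF n] .
      then have low: "c * real (N n) ^ (p + 1) \<le> expectation (\<lambda>\<omega>. S n \<omega> ^ 2)"
        using N by (simp add: field_simps)
      have "\<bar>m k n - real (k - 1) * m (k - 2) n\<bar> \<le> K / sqrt (c ^ k * real (N n))"
        unfolding moment[OF n] by (rule normalised_remainder_le[OF c(1) N K k _ low rem]) simp
      also have "\<dots> \<le> K / sqrt (c ^ k * real n)"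
        using N_ge[OF n] c(1) K n by (intro divide_left_mono real_sqrt_le_mono mult_left_mono mult_pos_pos) auto
      finally show ?thesis .
    qed
    have "(\<lambda>n. K / sqrt (c ^ k * real n)) \<longlonglongrightarrow> 0"
    proof -
      have "filterlim (\<lambda>n. c ^ k * real n) at_top sequentially"
        using c(1) by (intro filterlim_tendsto_pos_mult_at_top[OF tendsto_const]
            filterlim_real_sequentially) auto
      then have "filterlim (\<lambda>n. sqrt (c ^ k * real n)) at_infinity sequentially"
        by (intro filterlim_at_top_imp_at_infinity filterlim_compose[OF sqrt_at_top])
      then show ?thesis by (rule tendsto_divide_0[OF tendsto_const])
    qed
    then show "(\<lambda>n. m k n - real (k - 1) * m (k - 2) n) \<longlonglongrightarrow> 0"
    proof (rule Lim_null_comparison[rotated])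
      show "eventually (\<lambda>n. norm (m k n - real (k - 1) * m (k - 2) n) \<le> K / sqrt (c ^ k * real n)) sequentially"
        using eventually_ge_at_top[of 1] by eventually_elim (use bound in simp)
    qed
  qed
  then show ?thesis
    unfolding T_def[symmetric]
  proof (intro weak_conv_m_std_normal_of_moments)
    fix n k
    show "real_distribution (distr M borel (standardized (T n)))"
      by (rule real_distribution_distr) simp
    show "integrable (distr M borel (standardized (T n))) (\<lambda>x. x ^ k)"
      by (subst integrable_distr_eq) (auto intro: all_moments_integrable_power am)
    have "m k = (\<lambda>n. LINT x|distr M borel (standardized (T n)). x ^ k)"
      unfolding m_def by (intro ext integral_distr[symmetric]) auto
    then show "(\<lambda>n. LINT x|distr M borel (standardized (T n)). x ^ k)
        \<longlonglongrightarrow> (LINT x|std_normal_distribution. x ^ k)"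
      using \<open>\<And>k. m k \<longlonglongrightarrow> (LINT x|std_normal_distribution. x ^ k)\<close> by metis
  qed
qed

end
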